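(* Let $\Omega\subset\mathbb{H}$ be a circular domain and let $\mathcal{F}=(f_{[1]},\dots,f_{[N]})$ and $\mathcal{G}=(g_{[1]},\dots,g_{[N]})$ be two $N$-tuples of elements of $\mathcal{SEM}(\Omega)\setminus\{0\}$. The $\mathcal{SEM}_{\mathbb{R}}(\Omega)$-linear operator $\mathcal{L}_{\mathcal{F},\mathcal{G}}:\mathcal{SEM}(\Omega)\to\mathcal{SEM}(\Omega)$, $$\mathcal{L}_{\mathcal{F},\mathcal{G}}(\chi)=f_{[1]}*\chi*g_{[1]}+\cdots+f_{[N]}*\chi*g_{[N]},$$ is an isomorphism if and only if $$\det\left(\sum_{n=1}^{N}\imath_{L}(f_{[n]})\,\imath_{R}(g_{[n]})\right)\not\equiv 0.$$
   Context: $\mathbb{H}$ denotes the quaternions, $\mathbb{S}=\{q\in\mathbb{H}: q^2=-1\}$, and $\mathbb{C}_I=\mathbb{R}+I\mathbb{R}$ for $I\in\mathbb{S}$. For $q=x+Iy$ put $\mathbb{S}_q=\{x+Jy: J\in\mathbb{S}\}$. A domain (connected open set) $\Omega\subset\mathbb{H}$ is circular if $\mathbb{S}_q\subset\Omega$ for all $q\in\Omega$. A function $f$ on a circular open set $\Omega$ is slice regular ($f\in\mathcal{SR}(\Omega)$) if $f(x+Iy)=F_1(x,y)+IF_2(x,y)$ for all $x+Iy\in\Omega$ ($x,y\in\mathbb{R}$, $I\in\mathbb{S}$), with $\mathbb{H}$-valued $F_1$ even in $y$ and $F_2$ odd in $y$, and each restriction $f|_{\Omega\cap\mathbb{C}_I}$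 is real differentiable with $\frac12(\partial_x+I\partial_y)f|_{\Omega\cap\mathbb{C}_I}\equiv0$. The $*$-product is $(f*g)(q)=0$ if $f(q)=0$ and $(f*g)(q)=f(q)\,g(f(q)^{-1}qf(q))$ otherwise. $f$ is slice preserving if $f(\Omega\cap\mathbb{C}_I)\subset\mathbb{C}_I$ for every $I\in\mathbb{S}$. A function $f$ is slice semi-regular on $\Omega$ ($f\in\mathcal{SEM}(\Omega)$) if there is a circular open $\widetilde\Omega\subseteq\Omega$ with $f\in\mathcal{SR}(\widetilde\Omega)$ and each point of $\Omega\setminus\widetilde\Omega$ is a pole or a removable singularity; i.e. $\Omega\setminus\widetilde\Omega$ consists of isolated real points and isolated spheres $\mathbb{S}_p$, near each of which $\Delta_p^m f$ extends slice regularly for some integer $m\ge0$, where $\Delta_p(q)=q^2-2\mathrm{Re}(p)q+|p|^2$. Functions agreeing where both are defined are identified. $\mathcal{SEM}_{\mathbb{R}}(\Omega)$ is the subset of slice preserving elements; it is a field and the center of the algebra $(\mathcal{SEM}(\Omega),+,* )$, which is a 4-dimensional vector space over it. Fix an orthonormal basis $(1,I,J,K)$ of $\mathbb{H}$ with $I,J,K\in\mathbb{S}$ and $K=IJ$. Each $f\in\mathcal{SEM}(\Omega)$ is uniquely $f_0+f_1I+f_2J+f_3K$ with $f_\ell\in\mathcal{SEM}_{\mathbb{R}}(\Omega)$, and one sets $$\imath_{L}(f)=\begin{pmatrix} f_{0} & -f_{1} &-f_{2}&-f_{3}\\ f_{1} &f_{0}&-f_{3}&f_{2}\\ f_{2}&f_{3}&f_{0}&-f_{1}\\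 f_{3}&-f_{2}&f_{1}&f_{0}\end{pmatrix},\qquad \imath_{R}(f)=\begin{pmatrix} f_{0} & -f_{1} &-f_{2}&-f_{3}\\ f_{1} &f_{0}&f_{3}&-f_{2}\\ f_{2}&-f_{3}&f_{0}&f_{1}\\ f_{3}&f_{2}&-f_{1}&f_{0}\end{pmatrix}.$$ *)

theory Defs
  imports "HOL-Analysis.Analysis" "HOL-Algebra.Module" "HOL-Combinatorics.Permutations"
begin

section \<open>Quaternions\<close>

codatatype quat = Quat (qRe: real) (qIm1: real) (qIm2: real) (qIm3: real)

lemma quat_eq_iff:
  "x = y \<longleftrightarrow> qRe x = qRe y \<and> qIm1 x = qIm1 y \<and> qIm2 x = qIm2 y \<and> qIm3 x = qIm3 y"
  by (auto intro: quat.expand)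

instantiation quat :: ab_group_add
begin

primcorec zero_quat where
  "qRe 0 = 0" | "qIm1 0 = 0" | "qIm2 0 = 0" | "qIm3 0 = 0"

primcorec plus_quat where
  "qRe (x + y) = qRe x + qRe y"
| "qIm1 (x + y) = qIm1 x + qIm1 y"
| "qIm2 (x + y) = qIm2 x + qIm2 y"
| "qIm3 (x + y) = qIm3 x + qIm3 y"

primcorec uminus_quat where
  "qRe (- x) = - qRe x"
| "qIm1 (- x) = - qIm1 x"
| "qIm2 (- x) = - qIm2 x"
| "qIm3 (- x) = - qIm3 x"

primcorec minus_quat where
  "qRe (x - y) = qRe x - qRe y"
| "qIm1 (x - y) = qIm1 x - qIm1 y"
| "qIm2 (x - y) = qIm2 x - qIm2 y"
| "qIm3 (x - y) = qIm3 x - qIm3 y"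

instance
  by standard (simp_all add: quat_eq_iff)

end

instantiation quat :: ring_1
begin

primcorec one_quat where
  "qRe 1 = 1" | "qIm1 1 = 0" | "qIm2 1 = 0" | "qIm3 1 = 0"

primcorec times_quat where
  "qRe (x * y) = qRe x * qRe y - qIm1 x * qIm1 y - qIm2 x * qIm2 y - qIm3 x * qIm3 y"
| "qIm1 (x * y) = qRe x * qIm1 y + qIm1 x * qRe y + qIm2 x * qIm3 y - qIm3 x * qIm2 y"
| "qIm2 (x * y) = qRe x * qIm2 y - qIm1 x * qIm3 y + qIm2 x * qRe y + qIm3 x * qIm1 y"
| "qIm3 (x * y) = qRe x * qIm3 y + qIm1 x * qIm2 y - qIm2 x * qIm1 y + qIm3 x * qRe y"

instance
  by standard (simp_all add: quat_eq_iff algebra_simps)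

end

instantiation quat :: real_algebra_1
begin

primcorec scaleR_quat where
  "qRe (scaleR r x) = r * qRe x"
| "qIm1 (scaleR r x) = r * qIm1 x"
| "qIm2 (scaleR r x) = r * qIm2 x"
| "qIm3 (scaleR r x) = r * qIm3 x"

instance
  by standard (simp_all add: quat_eq_iff algebra_simps)

end

instantiation quat :: real_normed_div_algebra
begin

definition
  "norm (x :: quat) = sqrt ((qRe x)\<^sup>2 + (qIm1 x)\<^sup>2 + (qIm2 x)\<^sup>2 + (qIm3 x)\<^sup>2)"

definition
  "sgn (x :: quat) = x /\<^sub>R norm x"

definition
  "dist x (y :: quat) = norm (x - y)"

definition
  "(uniformity :: (quat \<times> quat) filter) = (INF e\<in>{0 <..}. principal {(x, y :: quat). dist x y < e})"

definition
  "open (U :: quat set) \<longleftrightarrow> (\<forall>x\<in>U. eventually (\<lambda>(x', y). x' = x \<longrightarrow> y \<in> U) uniformity)"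

primcorec inverse_quat where
  "qRe (inverse x) = qRe x / (norm x)\<^sup>2"
| "qIm1 (inverse x) = - qIm1 x / (norm x)\<^sup>2"
| "qIm2 (inverse x) = - qIm2 x / (norm x)\<^sup>2"
| "qIm3 (inverse x) = - qIm3 x / (norm x)\<^sup>2"

definition
  "x div (y :: quat) = x * inverse y"

lemma norm_quat_power2:
  "(norm x)\<^sup>2 = (qRe x)\<^sup>2 + (qIm1 x)\<^sup>2 + (qIm2 x)\<^sup>2 + (qIm3 x)\<^sup>2" for x :: quat
  by (simp add: norm_quat_def)

lemma norm_quat_complex_pair:
  "norm x = norm (Complex (qRe x) (qIm1 x), Complex (qIm2 x) (qIm3 x))" for x :: quat
  by (simp add: norm_quat_def norm_Pair complex_norm add.assoc)

instance
proof
  fix x y :: quat and r :: real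
  show norm_0: "norm x = 0 \<longleftrightarrow> x = 0"
    unfolding norm_quat_complex_pair by (simp add: quat_eq_iff complex_eq_iff zero_prod_def)
  show "x \<noteq> 0 \<Longrightarrow> inverse x * x = 1" "x \<noteq> 0 \<Longrightarrow> x * inverse x = 1"
  proof -
    assume "x \<noteq> 0"
    then have "(norm x)\<^sup>2 \<noteq> 0"
      by (simp add: norm_0)
    then show "inverse x * x = 1" "x * inverse x = 1"
      by (simp_all add: quat_eq_iff add_divide_distrib [symmetric] diff_divide_distrib [symmetric])
        (simp_all add: norm_quat_power2 [unfolded power2_eq_square] power2_eq_square algebra_simps)
  qed
  show "x div y = x * inverse y"
    by (rule divide_quat_def)
  show "inverse (0 :: quat) = 0"
    by (simp add: quat_eq_iff)
  show "norm (x + y) \<le> norm x + norm y"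
    using norm_triangle_ineq [of "(Complex (qRe x) (qIm1 x), Complex (qIm2 x) (qIm3 x))"
        "(Complex (qRe y) (qIm1 y), Complex (qIm2 y) (qIm3 y))"]
    by (simp add: norm_quat_complex_pair complex_add)
  show "norm (r *\<^sub>R x) = \<bar>r\<bar> * norm x"
    by (simp add: norm_quat_def power_mult_distrib distrib_left [symmetric] real_sqrt_mult)
  show "norm (x * y) = norm x * norm y"
    unfolding norm_quat_def real_sqrt_mult [symmetric]
    by (rule arg_cong [of _ _ sqrt]) (simp add: power2_eq_square algebra_simps)
qed (simp_all add: sgn_quat_def dist_quat_def uniformity_quat_def open_quat_def)

end

instantiation quat :: real_inner
begin

definition
  "inner x (y :: quat) = qRe x * qRe y + qIm1 x * qIm1 y + qIm2 x * qIm2 y + qIm3 x * qIm3 y"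

instance
proof
  show norm_eq: "norm x = sqrt (inner x x)" for x :: quat
    by (simp add: norm_quat_def inner_quat_def power2_eq_square)
  show "inner x x = 0 \<longleftrightarrow> x = 0" for x :: quat
    by (metis norm_eq norm_eq_zero real_sqrt_eq_zero_cancel_iff)
qed (auto simp: inner_quat_def algebra_simps)

end

section \<open>Circular sets and slice regular functions\<close>

definition imag_units :: "quat set" (\<open>\<S>\<close>) where
  "\<S> = {q. q\<^sup>2 = - 1}"

definition slice_pt :: "quat \<Rightarrow> real \<Rightarrow> real \<Rightarrow> quat" where
  "slice_pt I x y = of_real x + I * of_real y"

definition slice_plane :: "quat \<Rightarrow> quat set" where
  "slice_plane I = {slice_pt I x y | x y. True}"

text \<open>The choice of \<open>x, y, I\<close> with \<open>q = x + I y\<close> is not unique, but the resulting set of all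
  \<open>x + J y\<close> does not depend on it; it is a singleton for real \<open>q\<close>.\<close>

definition sphere_of :: "quat \<Rightarrow> quat set" where
  "sphere_of q = {slice_pt J x y | x y I J. I \<in> \<S> \<and> J \<in> \<S> \<and> q = slice_pt I x y}"

definition circular :: "quat set \<Rightarrow> bool" where
  "circular U \<longleftrightarrow> (\<forall>q\<in>U. sphere_of q \<subseteq> U)"

definition slice_regular_on :: "quat set \<Rightarrow> (quat \<Rightarrow> quat) \<Rightarrow> bool" where
  "slice_regular_on U f \<longleftrightarrow>
     open U \<and> circular U \<and>
     (\<exists>F1 F2 :: real \<Rightarrow> real \<Rightarrow> quat.
        (\<forall>x y. F1 x (- y) = F1 x y) \<and> (\<forall>x y. F2 x (- y) = - F2 x y) \<and>
        (\<forall>I\<in>\<S>. \<forall>x y. slice_pt I x y \<in> U \<longrightarrow> f (slice_pt I x y) = F1 x y + I * F2 x y)) \<and>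
     (\<forall>I\<in>\<S>. \<forall>x y. slice_pt I x y \<in> U \<longrightarrow>
        (\<exists>D. ((\<lambda>(s, t). f (slice_pt I s t)) has_derivative D) (at (x, y)) \<and>
             (1/2) *\<^sub>R (D (1, 0) + I * D (0, 1)) = 0))"

definition sphere_poly :: "quat \<Rightarrow> quat \<Rightarrow> quat" where
  "sphere_poly p q = q\<^sup>2 - 2 * of_real (qRe p) * q + of_real ((norm p)\<^sup>2)"

section \<open>Slice semi-regular functions\<close>

text \<open>A semi-regular function on \<open>\<Omega>\<close> is a partial function; its domain is the circular open subset
  of \<open>\<Omega>\<close> on which it is slice regular. The set \<open>V\<close> below is a neighbourhood of the sphere of \<open>p\<close>
  on which that sphere is the only one outside the domain.\<close>

definition semi_regular_on :: "quat set \<Rightarrow> (quat \<rightharpoonup> quat) \<Rightarrow> bool" where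
  "semi_regular_on \<Omega> f \<longleftrightarrow>
     dom f \<subseteq> \<Omega> \<and> slice_regular_on (dom f) (\<lambda>q. the (f q)) \<and>
     (\<forall>p\<in>\<Omega> - dom f. \<exists>V. open V \<and> circular V \<and> p \<in> V \<and> V \<subseteq> \<Omega> \<and> V - sphere_of p \<subseteq> dom f \<and>
        (\<exists>(m :: nat) h. slice_regular_on V h \<and>
           (\<forall>q\<in>V - sphere_of p. h q = sphere_poly p q ^ m * the (f q))))"

definition slice_preserving :: "(quat \<rightharpoonup> quat) \<Rightarrow> bool" where
  "slice_preserving f \<longleftrightarrow> (\<forall>I\<in>\<S>. (\<lambda>q. the (f q)) ` (dom f \<inter> slice_plane I) \<subseteq> slice_plane I)"

definition pconst :: "quat set \<Rightarrow> quat \<Rightarrow> (quat \<rightharpoonup> quat)" where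
  "pconst \<Omega> c = (\<lambda>q. Some c) |` \<Omega>"

definition padd :: "(quat \<rightharpoonup> quat) \<Rightarrow> (quat \<rightharpoonup> quat) \<Rightarrow> (quat \<rightharpoonup> quat)" where
  "padd f g = (\<lambda>q. Some (the (f q) + the (g q))) |` (dom f \<inter> dom g)"

text \<open>If \<open>dom g\<close> is circular, it contains the point at which \<open>g\<close> is evaluated, which lies on the
  sphere of \<open>q\<close>.\<close>

definition pstar :: "(quat \<rightharpoonup> quat) \<Rightarrow> (quat \<rightharpoonup> quat) \<Rightarrow> (quat \<rightharpoonup> quat)" where
  "pstar f g =
     (\<lambda>q. Some (if the (f q) = 0 then 0
                else the (f q) * the (g (inverse (the (f q)) * q * the (f q))))) |` (dom f \<inter> dom g)"

definition agree_rel :: "quat set \<Rightarrow> ((quat \<rightharpoonup> quat) \<times> (quat \<rightharpoonup> quat)) set" where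
  "agree_rel \<Omega> = {(f, g). semi_regular_on \<Omega> f \<and> semi_regular_on \<Omega> g \<and>
                         (\<forall>q\<in>dom f \<inter> dom g. f q = g q)}"

type_synonym semfun = "(quat \<rightharpoonup> quat) set"

definition sem_const :: "quat set \<Rightarrow> quat \<Rightarrow> semfun" where
  "sem_const \<Omega> c = agree_rel \<Omega> `` {pconst \<Omega> c}"

definition sem_add :: "quat set \<Rightarrow> semfun \<Rightarrow> semfun \<Rightarrow> semfun" where
  "sem_add \<Omega> A B = (\<Union>f\<in>A. \<Union>g\<in>B. agree_rel \<Omega> `` {padd f g})"

definition sem_star :: "quat set \<Rightarrow> semfun \<Rightarrow> semfun \<Rightarrow> semfun" where
  "sem_star \<Omega> A B = (\<Union>f\<in>A. \<Union>g\<in>B. agree_rel \<Omega> `` {pstar f g})"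

definition SEM_real_carrier :: "quat set \<Rightarrow> semfun set" where
  "SEM_real_carrier \<Omega> =
     {A \<in> {f. semi_regular_on \<Omega> f} // agree_rel \<Omega>. \<exists>f\<in>A. slice_preserving f}"

text \<open>The algebra of semi-regular functions with its module structure over the slice preserving
  ones, whose scalar multiplication is the star product.\<close>

definition SEM :: "quat set \<Rightarrow> (semfun, semfun) module" where
  "SEM \<Omega> = \<lparr>carrier = {f. semi_regular_on \<Omega> f} // agree_rel \<Omega>,
            monoid.mult = sem_star \<Omega>, one = sem_const \<Omega> 1,
            zero = sem_const \<Omega> 0, add = sem_add \<Omega>, smult = sem_star \<Omega>\<rparr>"

definition SEM_real :: "quat set \<Rightarrow> semfun ring" where
  "SEM_real \<Omega> = \<lparr>carrier = SEM_real_carrier \<Omega>,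
                 monoid.mult = sem_star \<Omega>, one = sem_const \<Omega> 1,
                 zero = sem_const \<Omega> 0, add = sem_add \<Omega>\<rparr>"

section \<open>Linear isomorphisms, matrices and determinants over ring records\<close>

definition module_iso ::
  "('r, 'k) ring_scheme \<Rightarrow> ('r, 'a, 'm) module_scheme \<Rightarrow> ('r, 'b, 'n) module_scheme \<Rightarrow> ('a \<Rightarrow> 'b) set"
  where
  "module_iso R M N =
     {h. bij_betw h (carrier M) (carrier N) \<and>
         (\<forall>x\<in>carrier M. \<forall>y\<in>carrier M. h (x \<oplus>\<^bsub>M\<^esub> y) = h x \<oplus>\<^bsub>N\<^esub> h y) \<and>
         (\<forall>a\<in>carrier R. \<forall>x\<in>carrier M. h (a \<odot>\<^bsub>M\<^esub> x) = a \<odot>\<^bsub>N\<^esub> h x)}"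

text \<open>An \<open>n \<times> n\<close> matrix over a ring record is a function of two indices below \<open>n\<close>, since the
  matrix types of the libraries need the entries to form a type class instance.\<close>

definition mat_mult ::
  "('a, 'm) ring_scheme \<Rightarrow> nat \<Rightarrow> (nat \<Rightarrow> nat \<Rightarrow> 'a) \<Rightarrow> (nat \<Rightarrow> nat \<Rightarrow> 'a) \<Rightarrow> (nat \<Rightarrow> nat \<Rightarrow> 'a)" where
  "mat_mult R n A B = (\<lambda>i j. \<Oplus>\<^bsub>R\<^esub>k\<in>{..<n}. A i k \<otimes>\<^bsub>R\<^esub> B k j)"

definition mat_sum ::
  "('a, 'm) ring_scheme \<Rightarrow> ('i \<Rightarrow> nat \<Rightarrow> nat \<Rightarrow> 'a) \<Rightarrow> 'i set \<Rightarrow> (nat \<Rightarrow> nat \<Rightarrow> 'a)" where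
  "mat_sum R A S = (\<lambda>i j. \<Oplus>\<^bsub>R\<^esub>s\<in>S. A s i j)"

definition mat_det :: "('a, 'm) ring_scheme \<Rightarrow> nat \<Rightarrow> (nat \<Rightarrow> nat \<Rightarrow> 'a) \<Rightarrow> 'a" where
  "mat_det R n A =
     (\<Oplus>\<^bsub>R\<^esub>p\<in>{p. p permutes {..<n}}.
        let t = (\<Otimes>\<^bsub>R\<^esub>i\<in>{..<n}. A i (p i)) in if evenperm p then t else \<ominus>\<^bsub>R\<^esub> t)"

section \<open>Coordinates and the two matrix representations\<close>

definition quat_frame :: "quat \<Rightarrow> quat \<Rightarrow> quat \<Rightarrow> bool" where
  "quat_frame I J K \<longleftrightarrow>
     I \<in> \<S> \<and> J \<in> \<S> \<and> K \<in> \<S> \<and> K = I * J \<and>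
     (\<forall>a<4. \<forall>b<4. inner ([1, I, J, K] ! a) ([1, I, J, K] ! b) = (if a = b then 1 else 0))"

definition sem_coords ::
  "quat set \<Rightarrow> quat \<Rightarrow> quat \<Rightarrow> quat \<Rightarrow> semfun \<Rightarrow> semfun \<times> semfun \<times> semfun \<times> semfun" where
  "sem_coords \<Omega> I J K f =
     (THE (f0, f1, f2, f3).
        f0 \<in> carrier (SEM_real \<Omega>) \<and> f1 \<in> carrier (SEM_real \<Omega>) \<and>
        f2 \<in> carrier (SEM_real \<Omega>) \<and> f3 \<in> carrier (SEM_real \<Omega>) \<and>
        f = f0 \<oplus>\<^bsub>SEM \<Omega>\<^esub> f1 \<otimes>\<^bsub>SEM \<Omega>\<^esub> sem_const \<Omega> I
               \<oplus>\<^bsub>SEM \<Omega>\<^esub> f2 \<otimes>\<^bsub>SEM \<Omega>\<^esub> sem_const \<Omega> J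
               \<oplus>\<^bsub>SEM \<Omega>\<^esub> f3 \<otimes>\<^bsub>SEM \<Omega>\<^esub> sem_const \<Omega> K)"

definition iota_L :: "quat set \<Rightarrow> quat \<Rightarrow> quat \<Rightarrow> quat \<Rightarrow> semfun \<Rightarrow> nat \<Rightarrow> nat \<Rightarrow> semfun" where
  "iota_L \<Omega> I J K f =
     (let (f0, f1, f2, f3) = sem_coords \<Omega> I J K f; neg = a_inv (SEM_real \<Omega>) in
      (\<lambda>i j. [[f0, neg f1, neg f2, neg f3],
              [f1, f0,     neg f3, f2    ],
              [f2, f3,     f0,     neg f1],
              [f3, neg f2, f1,     f0    ]] ! i ! j))"

definition iota_R :: "quat set \<Rightarrow> quat \<Rightarrow> quat \<Rightarrow> quat \<Rightarrow> semfun \<Rightarrow> nat \<Rightarrow> nat \<Rightarrow> semfun" where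
  "iota_R \<Omega> I J K f =
     (let (f0, f1, f2, f3) = sem_coords \<Omega> I J K f; neg = a_inv (SEM_real \<Omega>) in
      (\<lambda>i j. [[f0, neg f1, neg f2, neg f3],
              [f1, f0,     f3,     neg f2],
              [f2, neg f3, f0,     f1    ],
              [f3, f2,     neg f1, f0    ]] ! i ! j))"

definition sylvester_op ::
  "quat set \<Rightarrow> nat \<Rightarrow> (nat \<Rightarrow> semfun) \<Rightarrow> (nat \<Rightarrow> semfun) \<Rightarrow> semfun \<Rightarrow> semfun" where
  "sylvester_op \<Omega> N f g h =
     (\<Oplus>\<^bsub>SEM \<Omega>\<^esub>n\<in>{1..N}. f n \<otimes>\<^bsub>SEM \<Omega>\<^esub> h \<otimes>\<^bsub>SEM \<Omega>\<^esub> g n)"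

end

theory Submission
  imports Defs "HOL-Complex_Analysis.Meromorphic" "Jordan_Normal_Form.Determinant"
begin

text \<open>
  Slice regular functions are holomorphic functions in disguise. Write \<open>q = x + L y\<close> and
  \<open>z = x + \<i> y\<close>. Relative to the frame \<open>1, I, J, K\<close> a slice function
  \<open>F1(x, y) + L F2(x, y)\<close> has four complex coordinates \<open>F1\<^sub>a + \<i> F2\<^sub>a\<close>, and the parity of
  \<open>F1\<close> and \<open>F2\<close> says exactly that each coordinate \<open>\<phi>\<^sub>a\<close> satisfies \<open>\<phi>\<^sub>a(cnj z) = cnj (\<phi>\<^sub>a(z))\<close>.
  Such a quadruple is called a stem here. The function is slice regular iff its coordinates are
  holomorphic (\<open>slice_regular_stem_eval\<close>, \<open>slice_regular_stem\<close>), and semi-regular iff they are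
  meromorphic, because \<open>\<Delta>\<^sub>p\<close> becomes the polynomial \<open>(z - w) (z - cnj w)\<close>, where \<open>w\<close>
  belongs to \<open>p\<close> as \<open>z\<close> to \<open>q\<close>, and so cancels poles at \<open>w\<close> and at its conjugate (\<open>semi_regular_stem_fun\<close>, \<open>semi_regular_is_stem_fun\<close>).

  The classes of semi-regular functions are therefore the classes \<open>sem_of \<phi>\<close> of meromorphic stems,
  two stems being identified when they agree off a discrete set. In this description addition is
  pointwise, the star product is the pointwise product of complexified quaternions
  (\<open>pstar_stem_fun\<close>), and the slice preserving functions are the stems with a single coordinate
  \<open>u\<close>, the classes \<open>sem_scalar u\<close>. All ring identities thus reduce to identities between complex
  numbers that hold at almost every point. The only fact that needs more is that a nonzero
  slice preserving function is invertible: by the identity theorem and the connectedness of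
  \<open>\<Omega>\<close>, its coordinate vanishes almost everywhere or almost nowhere
  (\<open>scalar_zero_or_avoid\<close>).

  Left and right multiplication by complexified quaternions are given by the two matrices of the
  theorem, so in coordinates the operator is multiplication by the matrix function
  \<open>A = \<Sum>\<^sub>n \<iota>\<^sub>L(f\<^sub>n) \<iota>\<^sub>R(g\<^sub>n)\<close> (\<open>quat_prod_matrix\<close>). If the operator is surjective, preimages
  of the four basis vectors form a matrix \<open>X\<close> with \<open>A X = 1\<close>, so \<open>det A * det X = 1\<close> and
  \<open>det A\<close> is not zero. Conversely, if \<open>det A\<close> is not the zero class it is nonzero almost
  everywhere, and the adjugate of \<open>A\<close> divided by \<open>det A\<close> has meromorphic entries and inverts the
  operator (\<open>iso_iff_det\<close>).
\<close>

section \<open>Slices and their complex coordinate\<close>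

lemma imag_units_iff: "L \<in> \<S> \<longleftrightarrow> qRe L = 0 \<and> (qIm1 L)\<^sup>2 + (qIm2 L)\<^sup>2 + (qIm3 L)\<^sup>2 = 1"
proof
  assume "L \<in> \<S>"
  then have eq: "L\<^sup>2 = - 1" by (simp add: imag_units_def)
  then have c: "qRe L * qRe L - qIm1 L * qIm1 L - qIm2 L * qIm2 L - qIm3 L * qIm3 L = -1"
    "qRe L * qIm1 L = 0" "qRe L * qIm2 L = 0" "qRe L * qIm3 L = 0"
    by (simp_all add: quat_eq_iff power2_eq_square algebra_simps)
  have "qRe L = 0"
  proof (rule ccontr)
    assume "qRe L \<noteq> 0"
    then have "qRe L * qRe L = -1" using c by simp
    then show False using zero_le_square[of "qRe L"] by linarith
  qed
  then show "qRe L = 0 \<and> (qIm1 L)\<^sup>2 + (qIm2 L)\<^sup>2 + (qIm3 L)\<^sup>2 = 1"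
    using c(1) by (simp add: power2_eq_square)
next
  assume "qRe L = 0 \<and> (qIm1 L)\<^sup>2 + (qIm2 L)\<^sup>2 + (qIm3 L)\<^sup>2 = 1"
  then show "L \<in> \<S>"
    by (simp add: imag_units_def quat_eq_iff power2_eq_square)
qed

lemma imag_unit_square: "L \<in> \<S> \<Longrightarrow> L * L = - 1"
  by (simp add: imag_units_def power2_eq_square)

lemma imag_unit_square_left: "L \<in> \<S> \<Longrightarrow> L * (L * q) = - q"
  by (metis imag_unit_square mult.assoc mult_minus1)

lemma imag_units_uminus: "L \<in> \<S> \<Longrightarrow> - L \<in> \<S>"
  by (simp add: imag_units_iff)

definition slice_emb :: "quat \<Rightarrow> complex \<Rightarrow> quat" where
  "slice_emb L w = slice_pt L (Re w) (Im w)"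

lemma slice_pt_eq_emb: "slice_pt L x y = slice_emb L (Complex x y)"
  by (simp add: slice_emb_def)

lemma slice_emb_eq: "slice_emb L w = of_real (Re w) + L * of_real (Im w)"
  by (simp add: slice_emb_def slice_pt_def)

lemma slice_emb_eq_scaleR: "slice_emb L w = Re w *\<^sub>R 1 + Im w *\<^sub>R L"
  by (simp add: slice_emb_eq of_real_def)

lemma slice_emb_add: "slice_emb L (v + w) = slice_emb L v + slice_emb L w"
  by (simp add: slice_emb_eq_scaleR algebra_simps)

lemma slice_emb_0 [simp]: "slice_emb L 0 = 0" and slice_emb_1 [simp]: "slice_emb L 1 = 1"
  and slice_emb_of_real [simp]: "slice_emb L (of_real x) = of_real x"
  by (simp_all add: slice_emb_eq)

lemma slice_emb_uminus: "slice_emb L (- w) = - slice_emb L w"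
  by (simp add: slice_emb_eq_scaleR)

lemma slice_emb_diff: "slice_emb L (v - w) = slice_emb L v - slice_emb L w"
  by (simp add: slice_emb_eq_scaleR algebra_simps)

lemma slice_emb_mult: "L \<in> \<S> \<Longrightarrow> slice_emb L (v * w) = slice_emb L v * slice_emb L w"
  by (simp add: slice_emb_eq_scaleR algebra_simps imag_unit_square)

lemma slice_emb_power: "L \<in> \<S> \<Longrightarrow> slice_emb L (w ^ n) = slice_emb L w ^ n"
  by (induction n) (simp_all add: slice_emb_mult)

lemma slice_emb_cnj: "slice_emb L (cnj w) = slice_emb (- L) w"
  by (simp add: slice_emb_eq_scaleR)

lemma slice_emb_left_unit: "L \<in> \<S> \<Longrightarrow> L * slice_emb L w = slice_emb L (\<i> * w)"
  by (simp add: slice_emb_eq_scaleR algebra_simps imag_unit_square)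

lemma slice_emb_coords [simp]: "qRe (slice_emb L w) = Re w + Im w * qRe L" "qIm1 (slice_emb L w) =
    Im w * qIm1 L"
   "qIm2 (slice_emb L w) = Im w * qIm2 L" "qIm3 (slice_emb L w) = Im w * qIm3 L"
  by (simp_all add: slice_emb_eq_scaleR)

lemma of_real_quat_coords [simp]: "qRe (of_real r) = r" "qIm1 (of_real r) = 0"
  "qIm2 (of_real r) = 0" "qIm3 (of_real r) = 0"
  by (simp_all add: of_real_def)

text \<open>The representative with nonnegative imaginary part of the two complex numbers
  \<open>x \<plusminus> \<i> y\<close> that belong to \<open>q\<close>; it parametrizes the spheres \<open>\<S>\<^sub>q\<close>.\<close>

definition slice_coord :: "quat \<Rightarrow> complex" where
  "slice_coord q = Complex (qRe q) (norm (q - of_real (qRe q)))"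

lemma slice_coord_emb:
  assumes "L \<in> \<S>" shows "slice_coord (slice_emb L w) = Complex (Re w) \<bar>Im w\<bar>"
proof -
  have "norm (slice_emb L w - of_real (Re w)) =
      \<bar>Im w\<bar> * sqrt ((qIm1 L)\<^sup>2 + (qIm2 L)\<^sup>2 + (qIm3 L)\<^sup>2)"
    using assms by (simp add: norm_quat_def imag_units_iff power_mult_distrib flip: distrib_left)
  then show ?thesis using assms by (simp add: slice_coord_def imag_units_iff)
qed

lemma slice_coord_emb_cases: "L \<in> \<S> \<Longrightarrow> slice_coord (slice_emb L w) =
    w \<or> slice_coord (slice_emb L w) = cnj w"
  by (cases "Im w \<ge> 0") (simp_all add: slice_coord_emb complex_eq_iff)

text \<open>For real \<open>q\<close> every unit works, and an arbitrary one is chosen.\<close>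

lemma imag_unit_decomp: obtains L where "L \<in> \<S>" "q = slice_emb L (slice_coord q)"
proof (cases "q = of_real (qRe q)")
  case True
  have "Quat 0 1 0 0 \<in> \<S>" by (simp add: imag_units_iff)
  moreover from True have "slice_coord q = of_real (qRe q)"
    by (simp add: slice_coord_def complex_eq_iff)
  ultimately show ?thesis using that True by (metis slice_emb_of_real)
next
  case False
  define r where "r = norm (q - of_real (qRe q))"
  define L where "L = (1 / r) *\<^sub>R (q - of_real (qRe q))"
  have r: "r > 0" using False by (simp add: r_def)
  have r2: "r\<^sup>2 = (qIm1 q)\<^sup>2 + (qIm2 q)\<^sup>2 + (qIm3 q)\<^sup>2" by (simp add: r_def norm_quat_power2)
  have "L \<in> \<S>" using r r2
    by (auto simp: L_def imag_units_iff power_divide simp flip: add_divide_distrib)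
  moreover have "q = slice_emb L (slice_coord q)" using r
    by (simp add: L_def slice_coord_def slice_emb_eq_scaleR flip: r_def) (simp add: of_real_def)
  ultimately show ?thesis using that by blast
qed

lemma Im_slice_coord: "Im (slice_coord q) \<ge> 0" by (simp add: slice_coord_def)

lemma sphere_of_eq: "sphere_of q = {q'. slice_coord q' = slice_coord q}"
proof -
  have "slice_coord q' = slice_coord q" if "q' \<in> sphere_of q" for q'
    using that by (auto simp: sphere_of_def slice_pt_eq_emb slice_coord_emb)
  moreover have "q' \<in> sphere_of q" if "slice_coord q' = slice_coord q" for q'
  proof -
    obtain L L' where "L \<in> \<S>" "q = slice_emb L (slice_coord q)" "L' \<in> \<S>" "q' =
        slice_emb L' (slice_coord q')"
      by (metis imag_unit_decomp)
    then show ?thesis using that unfolding sphere_of_def slice_emb_def by fastforce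
  qed
  ultimately show ?thesis by blast
qed

lemma continuous_slice_coord: "continuous_on UNIV slice_coord"
proof -
  have lip: "\<bar>qRe p - qRe q\<bar> \<le> norm (p - q)" for p q :: quat
    unfolding norm_quat_def by (rule real_le_rsqrt) simp
  have re: "continuous_on UNIV qRe"
    unfolding continuous_on_iff dist_norm real_norm_def using lip by (meson order_le_less_trans)
  have "slice_coord = (\<lambda>q. of_real (qRe q) + \<i> * of_real (norm (q - of_real (qRe q))))"
    by (auto simp: slice_coord_def complex_eq_iff)
  then have "continuous_on UNIV slice_coord \<longleftrightarrow> continuous_on UNIV
      (\<lambda>q. complex_of_real (qRe q) + \<i> * complex_of_real (norm (q - of_real (qRe q))))"
    by (rule arg_cong)
  also have \<dots>
    by (intro continuous_intros re continuous_on_of_real)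
  finally show ?thesis .
qed

definition stem_dom :: "quat set \<Rightarrow> complex set" where
  "stem_dom U = {w. \<exists>L\<in>\<S>. slice_emb L w \<in> U}"

definition revolve :: "complex set \<Rightarrow> quat set" where
  "revolve E = {q. slice_coord q \<in> E}"

definition cnj_closed :: "complex set \<Rightarrow> bool" where
  "cnj_closed E \<longleftrightarrow> (\<forall>w\<in>E. cnj w \<in> E)"

lemma circular_iff: "circular U \<longleftrightarrow> (\<forall>q q'. q \<in> U \<longrightarrow> slice_coord q' = slice_coord q \<longrightarrow> q' \<in> U)"
  by (auto simp: circular_def sphere_of_eq)

lemma circular_revolve: "circular (revolve E)"
  by (simp add: circular_iff revolve_def)

lemma stem_dom_iff:
  assumes "circular U" "L \<in> \<S>" shows "w \<in> stem_dom U \<longleftrightarrow> slice_emb L w \<in> U"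
proof
  assume "w \<in> stem_dom U"
  then obtain L' where "L' \<in> \<S>" "slice_emb L' w \<in> U" by (auto simp: stem_dom_def)
  moreover from this have "slice_coord (slice_emb L w) = slice_coord (slice_emb L' w)" using assms
      by (simp add: slice_coord_emb)
  ultimately show "slice_emb L w \<in> U" using assms(1) by (simp add: circular_iff)
qed (use assms in \<open>auto simp: stem_dom_def\<close>)

lemma cnj_closed_stem_dom: "circular U \<Longrightarrow> cnj_closed (stem_dom U)"
  unfolding cnj_closed_def stem_dom_def
  by (auto simp: slice_emb_cnj dest: imag_units_uminus intro!: bexI[of _ "- _"])

lemma revolve_stem_dom:
  assumes U: "circular U" shows "revolve (stem_dom U) = U"
proof -
  have "q \<in> revolve (stem_dom U) \<longleftrightarrow> q \<in> U" for q
  proof -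
    obtain L where L: "L \<in> \<S>" "q = slice_emb L (slice_coord q)" by (rule imag_unit_decomp)
    show ?thesis
      using stem_dom_iff[OF U L(1), of "slice_coord q"] L(2) by (simp add: revolve_def)
  qed
  then show ?thesis by blast
qed

lemma slice_emb_in_revolve_iff: "cnj_closed E \<Longrightarrow> L \<in> \<S> \<Longrightarrow> slice_emb L w \<in> revolve E \<longleftrightarrow> w \<in> E"
  using slice_coord_emb_cases[of L w] complex_cnj_cnj[of w]
      by (auto simp: revolve_def cnj_closed_def)

lemma open_revolve: "open E \<Longrightarrow> open (revolve E)"
  using open_vimage[OF _ continuous_slice_coord] by (simp add: revolve_def vimage_def)

lemma continuous_slice_emb: "continuous_on UNIV (slice_emb L)"
  unfolding slice_emb_eq_scaleR[abs_def] by (intro continuous_intros)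

lemma open_stem_dom: "open U \<Longrightarrow> open (stem_dom U)"
proof -
  assume "open U"
  then have "open (\<Union>L\<in>\<S>. slice_emb L -` U)"
    by (intro open_UN ballI open_vimage continuous_slice_emb)
  moreover have "(\<Union>L\<in>\<S>. slice_emb L -` U) = stem_dom U" by (auto simp: stem_dom_def)
  ultimately show ?thesis by simp
qed

text \<open>The roots of \<open>\<Delta>\<^sub>p\<close> in each slice are the coordinate of \<open>p\<close> and its conjugate, so a power
  of \<open>\<Delta>\<^sub>p\<close> acts on stems as a complex polynomial that is real on the real axis.\<close>

lemma sphere_poly_emb:
  assumes "L \<in> \<S>"
  shows "sphere_poly p (slice_emb L w) =
      slice_emb L ((w - slice_coord p) * (w - cnj (slice_coord p)))"
proof -
  have "(norm p)\<^sup>2 = (Re (slice_coord p))\<^sup>2 + (Im (slice_coord p))\<^sup>2"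
    by (simp add: slice_coord_def norm_quat_power2)
  then have n: "complex_of_real ((norm p)\<^sup>2) = slice_coord p * cnj (slice_coord p)"
    by (simp add: complex_mult_cnj)
  have tr: "2 * of_real (qRe p) = slice_coord p + cnj (slice_coord p)"
      by (simp add: slice_coord_def complex_eq_iff)
  have "(w - slice_coord p) * (w - cnj (slice_coord p)) =
      w\<^sup>2 - 2 * of_real (qRe p) * w + of_real ((norm p)\<^sup>2)"
    unfolding n tr by (simp add: power2_eq_square algebra_simps)
  moreover have "slice_emb L (2 * of_real (qRe p) * w) = 2 * of_real (qRe p) * slice_emb L w"
    using assms slice_emb_of_real[of L "2 * qRe p"] by (simp add: slice_emb_mult)
  ultimately show ?thesis using assms
    by (simp add: sphere_poly_def slice_emb_add slice_emb_diff slice_emb_power)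
qed

section \<open>Coordinates with respect to a quaternion frame\<close>

text \<open>The square of a triple product is a Gram determinant.\<close>

lemma triple_product_square: "(v1*(a2*b3-a3*b2) + v2*(a3*b1-a1*b3) + v3*(a1*b2-a2*b1))\<^sup>2
   = (v1\<^sup>2+v2\<^sup>2+v3\<^sup>2) * ((a1\<^sup>2+a2\<^sup>2+a3\<^sup>2)*(b1\<^sup>2+b2\<^sup>2+b3\<^sup>2) - (a1*b1+a2*b2+a3*b3)\<^sup>2)
    - (v1*a1+v2*a2+v3*a3) * ((v1*a1+v2*a2+v3*a3)*(b1\<^sup>2+b2\<^sup>2+b3\<^sup>2) - (a1*b1+a2*b2+a3*b3) *
        (v1*b1+v2*b2+v3*b3))
    + (v1*b1+v2*b2+v3*b3) * ((v1*a1+v2*a2+v3*a3)*(a1*b1+a2*b2+a3*b3) - (a1\<^sup>2+a2\<^sup>2+a3\<^sup>2) *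
        (v1*b1+v2*b2+v3*b3))"
  for v1 v2 v3 a1 a2 a3 b1 b2 b3 :: real
  by (simp add: power2_eq_square algebra_simps)

text \<open>For orthonormal \<open>a\<close> and \<open>b\<close> the Gram determinant of \<open>v, a, b\<close> with \<open>v\<close> orthogonal to both is
  \<open>\<bar>v\<bar>\<^sup>2\<close>. It follows that the frame spans the quaternions.\<close>

lemma orthogonal_to_frame_eq_zero:
  assumes a: "a1\<^sup>2+a2\<^sup>2+a3\<^sup>2 = (1::real)" and b: "b1\<^sup>2+b2\<^sup>2+b3\<^sup>2 = 1" and ab: "a1*b1+a2*b2+a3*b3 =
      0"
    and va: "v1*a1+v2*a2+v3*a3 = 0" and vb: "v1*b1+v2*b2+v3*b3 = 0"
    and vk: "v1*(a2*b3-a3*b2) + v2*(a3*b1-a1*b3) + v3*(a1*b2-a2*b1) = 0"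
  shows "v1 = 0 \<and> v2 = 0 \<and> v3 = 0"
proof -
  have "v1\<^sup>2+v2\<^sup>2+v3\<^sup>2 = 0"
    using triple_product_square[of v1 a2 b3 a3 b2 v2 b1 a1 v3] unfolding a b ab va vb vk by simp
  moreover have "v1\<^sup>2 \<ge> 0" "v2\<^sup>2 \<ge> 0" "v3\<^sup>2 \<ge> 0" by simp_all
  ultimately have "v1\<^sup>2 = 0" "v2\<^sup>2 = 0" "v3\<^sup>2 = 0" by linarith+
  then show ?thesis by simp
qed

lemma sum4: "(\<Sum>a<4. h a) = h 0 + h 1 + h 2 + h (3::nat)" for h :: "nat \<Rightarrow> 'a::comm_monoid_add"
  by (simp add: eval_nat_numeral add.assoc)

lemma all4: "(\<forall>a<4. P a) \<longleftrightarrow> P 0 \<and> P 1 \<and> P 2 \<and> P (3::nat)"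
  by (auto simp: less_Suc_eq eval_nat_numeral)

lemma less4_cases: "a < 4 \<Longrightarrow> a = 0 \<or> a = Suc 0 \<or> a = 2 \<or> a = (3::nat)"
  by auto

text \<open>The argument of type \<^typ>\<open>nat\<close> numbers the coordinates; only the values below 4 matter.\<close>

type_synonym stem = "complex \<Rightarrow> nat \<Rightarrow> complex"

locale slice_frame =
  fixes I J K :: quat
  assumes frame: "quat_frame I J K"
begin

definition frame_vec :: "nat \<Rightarrow> quat" where "frame_vec a = [1, I, J, K] ! a"

lemma frame_vec_simps [simp]: "frame_vec 0 = 1" "frame_vec (Suc 0) = I" "frame_vec 2 =
    J" "frame_vec 3 = K"
  by (simp_all add: frame_vec_def eval_nat_numeral)

lemma frame_units: "I \<in> \<S>" "J \<in> \<S>" "K \<in> \<S>" and K_eq: "K = I * J"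
  using frame by (auto simp: quat_frame_def)

lemma frame_vec_orthonormal: "a < 4 \<Longrightarrow> b < 4 \<Longrightarrow> inner (frame_vec a) (frame_vec b) = (if a =
    b then 1 else 0)"
  using frame unfolding quat_frame_def frame_vec_def by blast

text \<open>For imaginary units, \<open>I J + J I\<close> is the real number \<open>- 2 \<langle>I, J\<rangle>\<close>.\<close>

lemma frame_anticommute: "J * I = - (I * J)"
proof -
  have "qRe I = 0" "qRe J = 0" using frame_units by (simp_all add: imag_units_iff)
  moreover have "inner I J = 0" using frame_vec_orthonormal[of 1 2] by simp
  ultimately show ?thesis
    by (simp add: quat_eq_iff inner_quat_def algebra_simps)
qed

lemma frame_mult_table: "I * I = -1" "J * J = -1" "K * K = -1" "I * J = K" "J * I = - K" "J * K =
    I" "K * J = - I"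
  "K * I = J" "I * K = - J"
proof -
  show I: "I * I = -1" and J: "J * J = -1" and "K * K = -1" using frame_units
      by (simp_all add: imag_unit_square)
  show "I * J = K" "J * I = - K" using K_eq frame_anticommute by simp_all
  have JIJ: "J * (I * J) = I"
    by (metis J frame_anticommute minus_mult_minus mult.assoc mult.right_neutral mult_minus_right
        mult_minus_left)
  then show "J * K = I" by (simp add: K_eq)
  show "K * J = - I" by (simp add: K_eq mult.assoc J)
  show "K * I = J"
    by (metis I K_eq frame_anticommute minus_mult_minus mult.assoc mult_1_left mult_minus_right
        mult_minus_left)
  show "I * K = - J" by (simp add: K_eq mult.assoc[symmetric] I)
qed

definition frame_coord :: "quat \<Rightarrow> nat \<Rightarrow> real" where "frame_coord q a = inner q (frame_vec a)"

lemma frame_coord_linear: "frame_coord (p + q) a =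
    frame_coord p a + frame_coord q a" "frame_coord (p - q) a = frame_coord p a - frame_coord q a"
  "frame_coord (r *\<^sub>R q) a = r * frame_coord q a" "frame_coord (- q) a =
      - frame_coord q a" "frame_coord 0 a = 0"
  by (simp_all add: frame_coord_def inner_add_left inner_diff_left)

lemma bounded_linear_frame_coord: "bounded_linear (\<lambda>q. frame_coord q a)"
  unfolding frame_coord_def by (rule bounded_linear_inner_left)

lemma frame_coord_sum: "a < 4 \<Longrightarrow> frame_coord (\<Sum>b<4. r b *\<^sub>R frame_vec b) a = r a"
  by (simp add: frame_coord_def inner_sum_left frame_vec_orthonormal if_distrib[of "(*) _"] cong:
      if_cong)

lemma frame_coord_expand: "q = (\<Sum>a<4. frame_coord q a *\<^sub>R frame_vec a)"
proof -
  define v where "v = q - (\<Sum>a<4. frame_coord q a *\<^sub>R frame_vec a)"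
  have o: "inner v (frame_vec a) = 0" if "a < 4" for a
    using frame_coord_sum[OF that, of "frame_coord q"]
        by (simp add: v_def frame_coord_linear flip: frame_coord_def)
  have re: "qRe v = 0" "qRe I = 0" "qRe J = 0"
    using o[of 0] frame_units by (simp_all add: inner_quat_def imag_units_iff)
  have vK: "inner v K = 0" using o[of 3] by simp
  have "qIm1 v = 0 \<and> qIm2 v = 0 \<and> qIm3 v = 0"
  proof (rule orthogonal_to_frame_eq_zero[of "qIm1 I" "qIm2 I" "qIm3 I" "qIm1 J" "qIm2 J" "qIm3 J"])
    show "(qIm1 I)\<^sup>2 + (qIm2 I)\<^sup>2 + (qIm3 I)\<^sup>2 = 1" "(qIm1 J)\<^sup>2 + (qIm2 J)\<^sup>2 + (qIm3 J)\<^sup>2 = 1"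
      using frame_units by (simp_all add: imag_units_iff)
    show "qIm1 I * qIm1 J + qIm2 I * qIm2 J + qIm3 I * qIm3 J = 0"
      using frame_vec_orthonormal[of 1 2] re by (simp add: inner_quat_def)
    show "qIm1 v * qIm1 I + qIm2 v * qIm2 I + qIm3 v * qIm3 I = 0"
      "qIm1 v * qIm1 J + qIm2 v * qIm2 J + qIm3 v * qIm3 J = 0"
      using o[of 1] o[of 2] re by (simp_all add: inner_quat_def)
    show "qIm1 v * (qIm2 I * qIm3 J - qIm3 I * qIm2 J) +
        qIm2 v * (qIm3 I * qIm1 J - qIm1 I * qIm3 J) +
      qIm3 v * (qIm1 I * qIm2 J - qIm2 I * qIm1 J) = 0"
      using vK re unfolding K_eq by (simp add: inner_quat_def algebra_simps)
  qed
  then have "v = 0" using re by (simp add: quat_eq_iff)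
  then show ?thesis by (simp add: v_def)
qed

definition stem_val :: "quat \<Rightarrow> (nat \<Rightarrow> complex) \<Rightarrow> quat" where
  "stem_val L c = (\<Sum>a<4. slice_emb L (c a) * frame_vec a)"

lemma stem_val_cong: "(\<And>a. a < 4 \<Longrightarrow> c a = d a) \<Longrightarrow> stem_val L c = stem_val L d"
  by (simp add: stem_val_def)

lemma stem_val_split:
  "stem_val L c = (\<Sum>a<4. Re (c a) *\<^sub>R frame_vec a) + L * (\<Sum>a<4. Im (c a) *\<^sub>R frame_vec a)"
  by (simp add: stem_val_def slice_emb_eq_scaleR distrib_right sum.distrib sum_distrib_left)

lemma stem_val_add: "stem_val L (\<lambda>a. c a + d a) = stem_val L c + stem_val L d"
  by (simp add: stem_val_def slice_emb_add distrib_right sum.distrib)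

lemma stem_val_cmult: "L \<in> \<S> \<Longrightarrow> stem_val L (\<lambda>a. w * d a) = slice_emb L w * stem_val L d"
  by (simp add: stem_val_def slice_emb_mult mult.assoc sum_distrib_left)

lemma stem_val_cnj: "stem_val L (\<lambda>a. cnj (c a)) = stem_val (- L) c"
  by (simp add: stem_val_def slice_emb_cnj)

text \<open>Values on the opposite half planes of one slice suffice to recover both components of a slice
  function; this makes the coordinates of a stem unique.\<close>

lemma opposite_units_determine:
  assumes "L \<in> \<S>" "p + L * q = p' + L * q'" "p - L * q = p' - L * q'"
  shows "p = p' \<and> q = (q'::quat)"
proof -
  have "2 *\<^sub>R p = 2 *\<^sub>R p'" using assms(2,3)
    by (metis add_diff_cancel_right' diff_add_eq scaleR_2 add_diff_eq diff_diff_eq2)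
  then have p: "p = p'" by simp
  then have "L * (L * q) = L * (L * q')" using assms(2) by simp
  then show ?thesis using p assms(1) by (simp add: imag_unit_square_left)
qed

lemma stem_val_inj:
  assumes "L \<in> \<S>" "stem_val L c = stem_val L d" "stem_val (- L) c = stem_val (- L) d" "a < 4"
  shows "c a = d a"
proof -
  have "(\<Sum>a<4. Re (c a) *\<^sub>R frame_vec a) = (\<Sum>a<4. Re (d a) *\<^sub>R frame_vec a) \<and>
    (\<Sum>a<4. Im (c a) *\<^sub>R frame_vec a) = (\<Sum>a<4. Im (d a) *\<^sub>R frame_vec a)"
    by (rule opposite_units_determine[OF assms(1)]) (use assms(2,3) in \<open>simp_all add:
        stem_val_split\<close>)
  then show ?thesis using frame_coord_sum[OF assms(4)] by (metis complex_eq_iff)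
qed

text \<open>Multiplication of quaternions with complex coefficients.\<close>

definition quat_prod :: "(nat \<Rightarrow> complex) \<Rightarrow> (nat \<Rightarrow> complex) \<Rightarrow> nat \<Rightarrow> complex" where
  "quat_prod c d a =
    [c 0 * d 0 - c 1 * d 1 - c 2 * d 2 - c 3 * d 3,
     c 0 * d 1 + c 1 * d 0 + c 2 * d 3 - c 3 * d 2,
     c 0 * d 2 - c 1 * d 3 + c 2 * d 0 + c 3 * d 1,
     c 0 * d 3 + c 1 * d 2 - c 2 * d 1 + c 3 * d 0] ! a"

lemma quat_prod_cong: "(\<And>a. a < 4 \<Longrightarrow> c a = c' a) \<Longrightarrow> (\<And>a. a < 4 \<Longrightarrow> d a = d' a) \<Longrightarrow> quat_prod c d a =
    quat_prod c' d' a"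
  unfolding quat_prod_def by simp

lemma quat_prod_simps:
  "quat_prod c d 0 = c 0 * d 0 - c 1 * d 1 - c 2 * d 2 - c 3 * d 3"
  "quat_prod c d (Suc 0) = c 0 * d 1 + c 1 * d 0 + c 2 * d 3 - c 3 * d 2"
  "quat_prod c d 2 = c 0 * d 2 - c 1 * d 3 + c 2 * d 0 + c 3 * d 1"
  "quat_prod c d 3 = c 0 * d 3 + c 1 * d 2 - c 2 * d 1 + c 3 * d 0"
  by (simp_all add: quat_prod_def eval_nat_numeral)

lemma slice_emb_mult_of_real: "slice_emb L (w * of_real r) =
    r *\<^sub>R slice_emb L w" "slice_emb L (of_real r * w) = r *\<^sub>R slice_emb L w"
  by (simp_all add: slice_emb_eq_scaleR algebra_simps)

lemma stem_val_mult_real: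
  "stem_val L c * (\<Sum>a<4. r a *\<^sub>R frame_vec a) = stem_val L (quat_prod c (\<lambda>a. of_real (r a)))"
  by (simp add: stem_val_def sum4 quat_prod_simps slice_emb_add slice_emb_diff
      slice_emb_mult_of_real algebra_simps frame_mult_table)

text \<open>The imaginary unit \<open>\<i>\<close> of the coefficients commutes with the frame, so the second factor may be
  split into its real and imaginary parts.\<close>

lemma quat_prod_split:
  assumes "a < 4"
  shows "quat_prod c (\<lambda>a. of_real (Re (d a))) a + \<i> * quat_prod c (\<lambda>a. of_real (Im (d a))) a =
      quat_prod c d a"
proof -
  show ?thesis using less4_cases[OF assms]
    by (elim disjE) (simp_all add: quat_prod_simps complex_eq_iff algebra_simps)
qed

text \<open>Conjugation by \<open>v\<close> is undone by the multiplication: \<open>v (v\<^sup>-\<^sup>1 L v) = L v\<close>. Hence the twisted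
  evaluation in the star product multiplies \<open>v\<close> by the real part of \<open>d\<close> and \<open>L v\<close> by its
  imaginary part, which is multiplication of the coefficients.\<close>

lemma stem_val_star:
  assumes L: "L \<in> \<S>" and v: "v = stem_val L c" "v \<noteq> 0"
  shows "v * stem_val (inverse v * L * v) d = stem_val L (quat_prod c d)"
proof -
  let ?G1 = "\<Sum>a<4. Re (d a) *\<^sub>R frame_vec a" and ?G2 = "\<Sum>a<4. Im (d a) *\<^sub>R frame_vec a"
  have "v * stem_val (inverse v * L * v) d = v * ?G1 + L * (v * ?G2)"
    using v(2) by (simp add: stem_val_split distrib_left mult.assoc[symmetric])
  also have "\<dots> = stem_val L (quat_prod c (\<lambda>a. of_real (Re (d a)))) +
      slice_emb L \<i> * stem_val L (quat_prod c (\<lambda>a. of_real (Im (d a))))"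
    by (simp add: v(1) stem_val_mult_real mult.assoc slice_emb_eq)
  also have "\<dots> = stem_val L (\<lambda>a. quat_prod c (\<lambda>a. of_real (Re (d a))) a +
       \<i> * quat_prod c (\<lambda>a. of_real (Im (d a))) a)"
    by (simp add: stem_val_add stem_val_cmult L)
  also have "\<dots> = stem_val L (quat_prod c d)"
    by (rule stem_val_cong) (rule quat_prod_split)
  finally show ?thesis .
qed

text \<open>The case distinction in the star product is consistent with the coefficient formula: the same
  splitting shows that the product vanishes with its first factor.\<close>

lemma stem_val_star_zero:
  assumes L: "L \<in> \<S>" and v: "stem_val L c = 0"
  shows "stem_val L (quat_prod c d) = 0"
proof -
  have "stem_val L (quat_prod c d) = stem_val L (\<lambda>a. quat_prod c (\<lambda>a. of_real (Re (d a))) a +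
       \<i> * quat_prod c (\<lambda>a. of_real (Im (d a))) a)"
    by (rule stem_val_cong) (simp add: quat_prod_split)
  then show ?thesis
    using v by (simp add: stem_val_add stem_val_cmult L flip: stem_val_mult_real)
qed

section \<open>Slice regular functions as holomorphic stems\<close>

definition unit_of :: "quat \<Rightarrow> quat" where
  "unit_of q = (SOME L. L \<in> \<S> \<and> q = slice_emb L (slice_coord q))"

lemma unit_of: "unit_of q \<in> \<S>" "slice_emb (unit_of q) (slice_coord q) = q"
proof -
  have "\<exists>L. L \<in> \<S> \<and> q = slice_emb L (slice_coord q)" by (metis imag_unit_decomp)
  from someI_ex[OF this] show "unit_of q \<in> \<S>" "slice_emb (unit_of q) (slice_coord q) = q"
    unfolding unit_of_def by auto
qed

text \<open>The symmetry is required at every point and not only on a domain, so that it is inherited by all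
  pointwise constructions.\<close>

definition stem_sym :: "stem \<Rightarrow> bool" where
  "stem_sym \<phi> \<longleftrightarrow> (\<forall>w. \<forall>a<4. \<phi> (cnj w) a = cnj (\<phi> w a))"

definition stem_eval :: "stem \<Rightarrow> quat \<Rightarrow> quat" where
  "stem_eval \<phi> q = stem_val (unit_of q) (\<phi> (slice_coord q))"

text \<open>A quaternion has two descriptions \<open>x + L y = x + (- L) (- y)\<close>, and a real one has many. The
  symmetry of the stem makes the value independent of the choice: it matches the first two, and
  it forces real coefficients at real points.\<close>

lemma stem_eval_emb:
  assumes "stem_sym \<phi>" "L \<in> \<S>"
  shows "stem_eval \<phi> (slice_emb L w) = stem_val L (\<phi> w)"
proof -
  define M where "M = unit_of (slice_emb L w)"
  define z where "z = slice_coord (slice_emb L w)"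
  have M: "M \<in> \<S>" "slice_emb M z = slice_emb L w" using unit_of by (simp_all add: M_def z_def)
  have ev: "stem_eval \<phi> (slice_emb L w) = stem_val M (\<phi> z)" by (simp add: stem_eval_def M_def z_def)
  have cn: "\<phi> (cnj w) a = cnj (\<phi> w a)" if "a < 4" for a
    using assms(1) that by (simp add: stem_sym_def)
  have zc: "z = w \<or> z = cnj w" using slice_coord_emb_cases[OF assms(2)] by (simp add: z_def)
  show ?thesis
  proof (cases "Im w = 0")
    case True
    then have "cnj w = w" by (simp add: complex_eq_iff)
    then have "Im (\<phi> w a) = 0" if "a < 4" for a
      using cn[OF that] by (metis complex_cnj_cancel_iff complex_eq_iff complex_cnj neg_equal_zero
          Im_complex_of_real cnj.simps(2))
    then have "stem_val M (\<phi> w) = stem_val L (\<phi> w)" by (simp add: stem_val_split)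
    then show ?thesis using ev zc \<open>cnj w = w\<close> by auto
  next
    case False
    from zc show ?thesis
    proof
      assume z: "z = w"
      then have "M = L" using M(2) False by (simp add: slice_emb_eq_scaleR)
      then show ?thesis using ev z by simp
    next
      assume z: "z = cnj w"
      then have "- M = L" using M(2) False
          by (simp add: slice_emb_eq_scaleR) (metis scaleR_cancel_left scaleR_minus_right)
      moreover have "stem_val M (\<phi> z) = stem_val M (\<lambda>a. cnj (\<phi> w a))"
        by (rule stem_val_cong) (simp add: z cn)
      ultimately show ?thesis using ev by (simp add: stem_val_cnj)
    qed
  qed
qed

lemma bounded_linear_slice_emb: "bounded_linear (slice_emb L)"
  unfolding slice_emb_eq_scaleR[abs_def]
  by (intro bounded_linear_add bounded_linear_scaleR_const bounded_linear_Re bounded_linear_Im)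

text \<open>On the slice of \<open>L\<close> the coordinates are complex differentiable with values in the same slice.
  Their derivative is multiplication by elements of that slice, which commute with \<open>L\<close>, and the
  frame vectors stand on the right; so the operator \<open>\<partial>\<^sub>x + L \<partial>\<^sub>y\<close> annihilates the sum.\<close>

lemma slice_regular_stem_eval:
  assumes E: "open E" "cnj_closed E" and sym: "stem_sym \<phi>"
    and hol: "\<And>a. a < 4 \<Longrightarrow> (\<lambda>w. \<phi> w a) holomorphic_on E"
  shows "slice_regular_on (revolve E) (stem_eval \<phi>)"
  unfolding slice_regular_on_def
proof (intro conjI)
  show "open (revolve E)" "circular (revolve E)" using E
      by (simp_all add: open_revolve circular_revolve)
  have cn: "\<phi> (Complex x (- y)) a = cnj (\<phi> (Complex x y) a)" if "a < 4" for x y a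
    using sym that unfolding stem_sym_def by (metis complex_cnj)
  show "\<exists>F1 F2. (\<forall>x y. F1 x (- y) = F1 x y) \<and> (\<forall>x y. F2 x (- y) = - F2 x y) \<and>
     (\<forall>L\<in>\<S>. \<forall>x y. slice_pt L x y \<in> revolve E \<longrightarrow> stem_eval \<phi> (slice_pt L x y) = F1 x y + L * F2 x y)"
    by (rule exI[of _ "\<lambda>x y. \<Sum>a<4. Re (\<phi> (Complex x y) a) *\<^sub>R frame_vec a"],
        rule exI[of _ "\<lambda>x y. \<Sum>a<4. Im (\<phi> (Complex x y) a) *\<^sub>R frame_vec a"])
       (simp add: cn slice_pt_eq_emb stem_eval_emb[OF sym] stem_val_split sum_negf)
  show "\<forall>L\<in>\<S>. \<forall>x y. slice_pt L x y \<in> revolve E \<longrightarrow>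
        (\<exists>D. ((\<lambda>(s, t). stem_eval \<phi> (slice_pt L s t)) has_derivative D) (at (x, y)) \<and>
             (1/2) *\<^sub>R (D (1, 0) + L * D (0, 1)) = 0)"
  proof (intro ballI allI impI)
    fix L x y assume L: "L \<in> \<S>" and "slice_pt L x y \<in> revolve E"
    then have w: "Complex x y \<in> E" using E by (simp add: slice_pt_eq_emb slice_emb_in_revolve_iff)
    define c where "c a = deriv (\<lambda>w. \<phi> w a) (Complex x y)" for a
    define D where "D = (\<lambda>h. \<Sum>a<4. slice_emb L (c a * Complex (fst h) (snd h)) * frame_vec a)"
    have pt: "((\<lambda>p. Complex (fst p) (snd p)) has_derivative (\<lambda>p. Complex (fst p) (snd p))) (at (x,
        y))"
      unfolding Complex_eq by (auto intro!: derivative_eq_intros)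
    have "((\<lambda>p. slice_emb L (\<phi> (Complex (fst p) (snd p)) a) * frame_vec a) has_derivative
         (\<lambda>h. slice_emb L (c a * Complex (fst h) (snd h)) * frame_vec a)) (at (x, y))"
             if "a < 4" for a
    proof -
      have "((\<lambda>w. \<phi> w a) has_field_derivative c a) (at (Complex x y))"
        unfolding c_def using holomorphic_derivI[OF hol[OF that] E(1) w] .
      then have "((\<lambda>w. \<phi> w a) has_derivative (*) (c a)) (at (Complex (fst (x, y)) (snd (x, y))))"
        by (simp add: has_field_derivative_def)
      from has_derivative_compose[OF pt this]
      have "((\<lambda>p. \<phi> (Complex (fst p) (snd p)) a) has_derivative
         (\<lambda>h. c a * Complex (fst h) (snd h))) (at (x, y))" .
      from bounded_linear.has_derivative[OF bounded_linear_slice_emb this]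
      show ?thesis by (rule has_derivative_mult_left)
    qed
    then have "((\<lambda>p. \<Sum>a<4. slice_emb L (\<phi> (Complex (fst p) (snd p)) a) * frame_vec a) has_derivative
        D) (at (x, y))"
      unfolding D_def by (intro has_derivative_sum) auto
    moreover have "(\<lambda>(s, t). stem_eval \<phi> (slice_pt L s t)) =
        (\<lambda>p. \<Sum>a<4. slice_emb L (\<phi> (Complex (fst p) (snd p)) a) * frame_vec a)"
      using L by (auto simp: slice_pt_eq_emb stem_eval_emb[OF sym] stem_val_def)
    moreover have "D (1, 0) + L * D (0, 1) = 0"
    proof -
      have i: "Complex 0 1 = \<i>" "Complex 1 0 = 1" by (simp_all add: complex_eq_iff)
      have "L * D (0, 1) = (\<Sum>a<4. slice_emb L (\<i> * (c a * \<i>)) * frame_vec a)"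
        by (simp add: D_def sum_distrib_left mult.assoc[symmetric] slice_emb_left_unit[OF L] i)
      then show ?thesis by (simp add: D_def i slice_emb_uminus sum_negf mult.left_commute[of \<i>])
    qed
    ultimately show "\<exists>D. ((\<lambda>(s, t). stem_eval \<phi> (slice_pt L s t)) has_derivative D) (at (x, y)) \<and>
             (1/2) *\<^sub>R (D (1, 0) + L * D (0, 1)) = 0"
      by (intro exI[of _ D]) simp
  qed
qed

text \<open>The components are averages of values on the slices of \<open>L\<close> and \<open>- L\<close>, and hence differentiable. The
  two regularity conditions \<open>\<partial>\<^sub>x f \<plusminus> L \<partial>\<^sub>y f = 0\<close> together are the Cauchy-Riemann equations
  \<open>\<partial>\<^sub>x F1 = \<partial>\<^sub>y F2\<close> and \<open>\<partial>\<^sub>x F2 = - \<partial>\<^sub>y F1\<close>.\<close>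

lemma slice_regular_stem:
  assumes reg: "slice_regular_on U f"
  obtains \<phi> where "stem_sym \<phi>" "\<And>a. a < 4 \<Longrightarrow> (\<lambda>w. \<phi> w a) holomorphic_on stem_dom U"
    "\<And>q. q \<in> U \<Longrightarrow> f q = stem_eval \<phi> q"
proof -
  from reg obtain F1 F2 where U: "open U" "circular U"
    and even: "\<And>x y. F1 x (- y) = F1 x y" and odd: "\<And>x y. F2 x (- y) = - F2 x y"
    and f: "\<And>L x y. L \<in> \<S> \<Longrightarrow> slice_pt L x y \<in> U \<Longrightarrow> f (slice_pt L x y) = F1 x y + L * F2 x y"
    unfolding slice_regular_on_def by blast
  from reg have der: "\<exists>D. ((\<lambda>(s, t). f (slice_pt L s t)) has_derivative D) (at (x, y)) \<and>
             (1/2) *\<^sub>R (D (1, 0) + L * D (0, 1)) = 0" if "L \<in> \<S>" "slice_pt L x y \<in> U" for L x y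
    using that unfolding slice_regular_on_def by blast
  let ?E = "stem_dom U"
  have E: "open ?E" using U by (rule_tac open_stem_dom)
  define \<phi> where "\<phi> w a =
      Complex (frame_coord (F1 (Re w) (Im w)) a) (frame_coord (F2 (Re w) (Im w)) a)" for w a
  have sym: "stem_sym \<phi>"
    by (simp add: stem_sym_def \<phi>_def even odd frame_coord_linear complex_eq_iff)
  have sv: "stem_val L (\<phi> w) = F1 (Re w) (Im w) + L * F2 (Re w) (Im w)" for L w
    unfolding stem_val_split by (simp add: \<phi>_def flip: frame_coord_expand)
  show ?thesis
  proof (rule that[OF sym])
    fix q assume q: "q \<in> U"
    obtain L where L: "L \<in> \<S>" "q = slice_emb L (slice_coord q)" by (rule imag_unit_decomp)
    then have "f q = F1 (Re (slice_coord q)) (Im (slice_coord q)) +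
        L * F2 (Re (slice_coord q)) (Im (slice_coord q))"
      using f[OF L(1), of "Re (slice_coord q)" "Im (slice_coord q)"] q unfolding slice_emb_def
          by metis
    also have "\<dots> = stem_eval \<phi> q" using stem_eval_emb[OF sym L(1), of "slice_coord q"] L(2)
        by (simp add: sv)
    finally show "f q = stem_eval \<phi> q" .
  next
    fix a :: nat assume "a < 4"
    have "(\<lambda>w. \<phi> w a) field_differentiable (at w0)" if w0: "w0 \<in> ?E" for w0
    proof -
      obtain L where L: "L \<in> \<S>" by (rule imag_unit_decomp)
      then have mL: "- L \<in> \<S>" by (rule imag_units_uminus)
      have LL: "L * (L * q) = - q" for q using L by (rule imag_unit_square_left)
      let ?x = "Re w0" and ?y = "Im w0"
      have inE: "slice_pt M s t \<in> U \<longleftrightarrow> Complex s t \<in> ?E" if "M \<in> \<S>" for M s t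
        using stem_dom_iff[OF U(2) that] by (simp add: slice_pt_eq_emb)
      obtain P where P: "((\<lambda>(s, t). f (slice_pt L s t)) has_derivative P) (at (?x, ?y))"
          "P (1, 0) + L * P (0, 1) = 0"
        using der[OF L, of ?x ?y] inE[OF L] w0 by auto
      obtain Q where Q: "((\<lambda>(s, t). f (slice_pt (- L) s t)) has_derivative Q) (at (?x, ?y))"
          "Q (1, 0) - L * Q (0, 1) = 0"
        using der[OF mL, of ?x ?y] inE[OF mL] w0 by auto
      interpret P: bounded_linear P using P(1) by (rule has_derivative_bounded_linear)
      interpret Q: bounded_linear Q using Q(1) by (rule has_derivative_bounded_linear)
      have pt: "((\<lambda>w. (Re w, Im w)) has_derivative (\<lambda>w. (Re w, Im w))) (at w0)"
        by (intro derivative_intros)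
      have P': "((\<lambda>w. f (slice_emb L w)) has_derivative (\<lambda>h. P (Re h, Im h))) (at w0)"
        using has_derivative_compose[OF pt P(1)] by (simp add: slice_emb_def)
      have Q': "((\<lambda>w. f (slice_emb (- L) w)) has_derivative (\<lambda>h. Q (Re h, Im h))) (at w0)"
        using has_derivative_compose[OF pt Q(1)] by (simp add: slice_emb_def)
      define D where "D h = of_real (frame_coord ((1/2) *\<^sub>R (P (Re h, Im h) + Q (Re h, Im h))) a) +
         \<i> * of_real (frame_coord ((-1/2) *\<^sub>R (L * (P (Re h, Im h) - Q (Re h, Im h)))) a)" for h
      have der1: "((\<lambda>w. complex_of_real (frame_coord ((1/2) *\<^sub>R (f (slice_emb L w) +
          f (slice_emb (- L) w))) a) +
         \<i> * of_real (frame_coord ((-1/2) *\<^sub>R (L * (f (slice_emb L w) - f (slice_emb (- L) w)))) a))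
             has_derivative D) (at w0)"
        unfolding D_def
        by (intro has_derivative_add has_derivative_mult_right has_derivative_of_real
            bounded_linear.has_derivative[OF bounded_linear_frame_coord] has_derivative_scaleR_right
            has_derivative_diff P' Q')
      have eq: "complex_of_real (frame_coord ((1/2) *\<^sub>R (f (slice_emb L w) +
          f (slice_emb (- L) w))) a) +
         \<i> * of_real (frame_coord ((-1/2) *\<^sub>R (L * (f (slice_emb L w) - f (slice_emb (- L) w)))) a)
             = \<phi> w a" if "w \<in> ?E" for w
      proof -
        have w: "slice_emb M w \<in> U" if "M \<in> \<S>" for M using that \<open>w \<in> ?E\<close> stem_dom_iff[OF U(2)]
            by blast
        have 1: "f (slice_emb L w) = F1 (Re w) (Im w) + L * F2 (Re w) (Im w)"
          "f (slice_emb (- L) w) = F1 (Re w) (Im w) - L * F2 (Re w) (Im w)"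
          using f[OF L] f[OF mL] w[OF L] w[OF mL] by (simp_all add: slice_emb_def)
        have "(1/2) *\<^sub>R (f (slice_emb L w) + f (slice_emb (- L) w)) = F1 (Re w) (Im w)"
          unfolding 1 by (simp add: scaleR_2[symmetric])
        moreover have "(-1/2) *\<^sub>R (L * (f (slice_emb L w) - f (slice_emb (- L) w))) =
            F2 (Re w) (Im w)"
          unfolding 1 by (simp add: distrib_left LL scaleR_2[symmetric])
        ultimately show ?thesis by (simp add: \<phi>_def Complex_eq)
      qed
      have der2: "((\<lambda>w. \<phi> w a) has_derivative D) (at w0)"
        by (rule has_derivative_transform_within_open[OF der1 E w0 eq])
      have hh: "(Re h, Im h) = Re h *\<^sub>R (1, 0) + Im h *\<^sub>R (0, 1)" for h by simp
      have PP: "P (Re h, Im h) = Re h *\<^sub>R (- (L * P (0, 1))) + Im h *\<^sub>R P (0, 1)" for h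
      proof -
        have "P (1, 0) = - (L * P (0, 1))" using P(2) by (simp add: eq_neg_iff_add_eq_0)
        then show ?thesis unfolding hh P.add P.scaleR by simp
      qed
      have QQ: "Q (Re h, Im h) = Re h *\<^sub>R (L * Q (0, 1)) + Im h *\<^sub>R Q (0, 1)" for h
        unfolding hh Q.add Q.scaleR using Q(2) by simp
      \<comment> \<open>The coordinates of \<open>\<partial>\<^sub>x F1\<close> and \<open>\<partial>\<^sub>x F2\<close>, expressed by the derivatives of \<open>f\<close> in the
        direction of \<open>y\<close> on the two slices.\<close>
      define c where "c = Complex (frame_coord ((1/2) *\<^sub>R (L * (Q (0, 1) - P (0, 1)))) a) (-
          frame_coord ((1/2) *\<^sub>R (P (0, 1) + Q (0, 1))) a)"
      have "D h = c * h" for h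
        unfolding D_def PP QQ c_def
        by (simp add: complex_eq_iff frame_coord_linear algebra_simps LL)
      then have "D = (*) c" by blast
      then have "((\<lambda>w. \<phi> w a) has_field_derivative c) (at w0)"
        using der2 by (simp add: has_field_derivative_def)
      then show ?thesis by (auto simp: field_differentiable_def)
    qed
    then show "(\<lambda>w. \<phi> w a) holomorphic_on ?E"
      using E by (auto simp: holomorphic_on_def intro: field_differentiable_at_within)
  qed
qed

end

lemma slice_regular_cong:
  assumes reg: "slice_regular_on U f" and eq: "\<And>q. q \<in> U \<Longrightarrow> g q = f q"
  shows "slice_regular_on U g"
  unfolding slice_regular_on_def
proof (intro conjI)
  show U: "open U" "circular U"
    using reg by (simp_all add: slice_regular_on_def)
  show "\<exists>F1 F2. (\<forall>x y. F1 x (- y) = F1 x y) \<and> (\<forall>x y. F2 x (- y) = - F2 x y) \<and>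
     (\<forall>L\<in>\<S>. \<forall>x y. slice_pt L x y \<in> U \<longrightarrow> g (slice_pt L x y) = F1 x y + L * F2 x y)"
    using reg eq unfolding slice_regular_on_def by metis
  show "\<forall>L\<in>\<S>. \<forall>x y. slice_pt L x y \<in> U \<longrightarrow>
        (\<exists>D. ((\<lambda>(s, t). g (slice_pt L s t)) has_derivative D) (at (x, y)) \<and>
             (1/2) *\<^sub>R (D (1, 0) + L * D (0, 1)) = 0)"
  proof (intro ballI allI impI)
    fix L x y assume L: "L \<in> \<S>" "slice_pt L x y \<in> U"
    obtain D where D: "((\<lambda>(s, t). f (slice_pt L s t)) has_derivative D) (at (x, y))"
      "(1/2) *\<^sub>R (D (1, 0) + L * D (0, 1)) = 0"
      using reg L unfolding slice_regular_on_def by blast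
    have "open ((\<lambda>p. slice_pt L (fst p) (snd p)) -` U)"
      by (rule open_vimage[OF U(1)]) (auto simp: slice_pt_def intro!: continuous_intros)
    then have "((\<lambda>(s, t). g (slice_pt L s t)) has_derivative D) (at (x, y))"
      by (rule has_derivative_transform_within_open[OF D(1)]) (use L eq in auto)
    then show "\<exists>D. ((\<lambda>(s, t). g (slice_pt L s t)) has_derivative D) (at (x, y)) \<and>
             (1/2) *\<^sub>R (D (1, 0) + L * D (0, 1)) = 0" using D(2) by blast
  qed
qed

section \<open>Semi-regular functions as meromorphic stems\<close>

text \<open>Exponents above the order of the pole suffice. The product then tends to 0, which is
  also its value at the point because the polynomial vanishes there, so the function is analytic
  without any correction of its value.\<close>

lemma meromorphic_pole_cancel:
  assumes "f meromorphic_on {z}"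
  shows "\<exists>n. \<forall>m\<ge>n. (\<lambda>w. ((w - z) * (w - c)) ^ m * f w) analytic_on {z}"
proof -
  from assms obtain F where F: "(\<lambda>w. f (z + w)) has_laurent_expansion F"
    by (auto simp: meromorphic_on_def)
  define n where "n = Suc (nat (- fls_subdegree F))"
  have "(\<lambda>w. ((w - z) * (w - c)) ^ m * f w) analytic_on {z}" if m: "m \<ge> n" for m
  proof (rule meromorphic_at_isCont_imp_analytic)
    show "(\<lambda>w. ((w - z) * (w - c)) ^ m * f w) meromorphic_on {z}"
      by (intro meromorphic_intros assms)
    have "(\<lambda>w. w ^ m * f (z + w)) has_laurent_expansion fls_X ^ m * F"
      by (intro laurent_expansion_intros F)
    moreover have "F = 0 \<or> fls_subdegree (fls_X ^ m * F) > 0"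
    proof (cases "F = 0")
      case False
      then have "fls_subdegree (fls_X ^ m * F) = int m + fls_subdegree F"
        by (subst fls_subdegree_mult) (simp_all add: fls_subdegree_pow)
      moreover have "int m > - fls_subdegree F" using m unfolding n_def by linarith
      ultimately show ?thesis by simp
    qed simp
    ultimately have "(\<lambda>w. w ^ m * f (z + w)) has_laurent_expansion fls_X ^ m * F"
      and "fls_subdegree (fls_X ^ m * F) \<ge> 0" "fls_nth (fls_X ^ m * F) 0 = 0" by auto
    from has_laurent_expansion_imp_tendsto_0[OF this(1,2)] this(3)
    have "(\<lambda>w. w ^ m * f (z + w)) \<midarrow>0\<rightarrow> 0" by simp
    then have "(\<lambda>w. (w - z) ^ m * f w) \<midarrow>z\<rightarrow> 0"
      by (intro LIM_offset_zero_cancel[of _ z]) simp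
    then have "(\<lambda>w. (w - c) ^ m * ((w - z) ^ m * f w)) \<midarrow>z\<rightarrow> (z - c) ^ m * 0"
      by (intro tendsto_intros)
    then show "isCont (\<lambda>w. ((w - z) * (w - c)) ^ m * f w) z"
      using m by (simp add: isCont_def n_def power_mult_distrib mult_ac power_0_left)
  qed
  then show ?thesis by blast
qed

lemma open_cnj_image:
  assumes "open X" shows "open (cnj ` X)"
proof -
  have "cnj ` X = cnj -` X" by (auto simp: image_iff) (metis complex_cnj_cnj)
  moreover have "open (cnj -` X)" by (rule open_vimage[OF assms]) (intro continuous_intros)
  ultimately show ?thesis by simp
qed

text \<open>Schwarz reflection.\<close>

lemma (in slice_frame) stem_analytic_cnj:
  assumes \<phi>: "stem_sym \<phi>" "a < 4" and an: "(\<lambda>w. \<phi> w a) analytic_on {z}"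
  shows "(\<lambda>w. \<phi> w a) analytic_on {cnj z}"
proof -
  obtain d where d: "d > 0" "(\<lambda>w. \<phi> w a) holomorphic_on ball z d"
    using an by (auto simp: analytic_on_def)
  have "(cnj \<circ> (\<lambda>w. \<phi> w a) \<circ> cnj) holomorphic_on (cnj ` ball z d)"
    by (rule holomorphic_on_compose_cnj_cnj) (use d(2) in \<open>simp_all add: image_image
        open_cnj_image\<close>)
  moreover have "cnj \<circ> (\<lambda>w. \<phi> w a) \<circ> cnj = (\<lambda>w. \<phi> w a)"
    using \<phi> by (auto simp: stem_sym_def)
  ultimately have "(\<lambda>w. \<phi> w a) analytic_on (cnj ` ball z d)"
    using analytic_on_open[OF open_cnj_image[OF open_ball]] by metis
  then show ?thesis by (rule analytic_on_subset) (use d in auto)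
qed

locale stem_setup = slice_frame +
  fixes \<Omega> :: "quat set"
  assumes open_\<Omega>: "open \<Omega>" and connected_\<Omega>: "connected \<Omega>" and circular_\<Omega>: "circular \<Omega>"
    and nonempty_\<Omega>: "\<Omega> \<noteq> {}"
begin

text \<open>This set need not be connected: if \<open>\<Omega>\<close> contains no real point, it consists of two
  conjugate parts.\<close>

definition stem_plane :: "complex set" where "stem_plane = stem_dom \<Omega>"

lemma stem_plane: "open stem_plane" "cnj_closed stem_plane" "revolve stem_plane =
    \<Omega>" "stem_plane \<noteq> {}"
proof -
  show "open stem_plane" "cnj_closed stem_plane" "revolve stem_plane = \<Omega>"
    using open_\<Omega> circular_\<Omega>
        by (simp_all add: stem_plane_def open_stem_dom cnj_closed_stem_dom revolve_stem_dom)
  then show "stem_plane \<noteq> {}" using nonempty_\<Omega> by (auto simp: revolve_def)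
qed

lemma cnj_stem_plane [simp]: "cnj w \<in> stem_plane \<longleftrightarrow> w \<in> stem_plane"
  using stem_plane(2) unfolding cnj_closed_def by (metis complex_cnj_cnj)

definition stems :: "stem set" where
  "stems = {\<phi>. stem_sym \<phi> \<and> (\<forall>a<4. (\<lambda>w. \<phi> w a) meromorphic_on stem_plane)}"

text \<open>\<open>E\<close> may be smaller than the set where the stem is holomorphic: the domain of a
  partial function need not be maximal.\<close>

definition regular_on :: "stem \<Rightarrow> complex set \<Rightarrow> bool" where
  "regular_on \<phi> E \<longleftrightarrow> \<phi> \<in> stems \<and> open E \<and> cnj_closed E \<and> E \<subseteq> stem_plane \<and> (\<forall>\<^sub>\<approx>w\<in>stem_plane. w \<in> E) \<and>
     (\<forall>a<4. (\<lambda>w. \<phi> w a) holomorphic_on E)"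

definition stem_fun :: "stem \<Rightarrow> complex set \<Rightarrow> quat \<rightharpoonup> quat" where
  "stem_fun \<phi> E = (\<lambda>q. Some (stem_eval \<phi> q)) |` revolve E"

lemma dom_stem_fun [simp]: "dom (stem_fun \<phi> E) = revolve E"
  by (auto simp: stem_fun_def restrict_map_def split: if_splits)

lemma stem_fun_apply: "q \<in> revolve E \<Longrightarrow> stem_fun \<phi> E q = Some (stem_eval \<phi> q)"
  by (simp add: stem_fun_def)

text \<open>Near an omitted sphere the witness is \<open>\<Delta>\<^sub>p\<^sup>m\<close> times the function. The neighbourhood is the
  union of a disc around the coordinate of \<open>p\<close> with its mirror image. Analyticity at the
  coordinate comes from the cancellation of the pole, and at its conjugate from reflection.\<close>

lemma semi_regular_stem_fun:
  assumes regular_on: "regular_on \<phi> E"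
  shows "semi_regular_on \<Omega> (stem_fun \<phi> E)"
  unfolding semi_regular_on_def dom_stem_fun
proof (intro conjI ballI)
  from regular_on have \<phi>: "stem_sym \<phi>" "\<And>a. a < 4 \<Longrightarrow> (\<lambda>w. \<phi> w a) meromorphic_on stem_plane"
    and E: "open E" "cnj_closed E" "E \<subseteq> stem_plane" "\<forall>\<^sub>\<approx>w\<in>stem_plane. w \<in> E"
    and hol: "\<And>a. a < 4 \<Longrightarrow> (\<lambda>w. \<phi> w a) holomorphic_on E"
    by (auto simp: regular_on_def stems_def)
  show "revolve E \<subseteq> \<Omega>" using E(3) stem_plane(3) by (auto simp: revolve_def)
  show "slice_regular_on (revolve E) (\<lambda>q. the (stem_fun \<phi> E q))"
    using slice_regular_stem_eval[OF E(1,2) \<phi>(1) hol]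
        by (rule slice_regular_cong) (simp_all add: stem_fun_apply)
  fix p assume p: "p \<in> \<Omega> - revolve E"
  define z where "z = slice_coord p"
  have z: "z \<in> stem_plane" "Im z \<ge> 0" using p stem_plane(3)
      by (auto simp: z_def revolve_def Im_slice_coord)
  have "eventually (\<lambda>w. w \<in> E) (at z)"
    using E(4) z(1) by (rule eventually_cosparse_imp_eventually_at)
  then obtain r1 where r1: "r1 > 0" "\<And>w. w \<noteq> z \<Longrightarrow> dist w z < r1 \<Longrightarrow> w \<in> E"
    by (auto simp: eventually_at)
  obtain r2 where r2: "r2 > 0" "ball z r2 \<subseteq> stem_plane" using stem_plane(1) z(1)
      by (auto simp: open_contains_ball)
  define A where "A = ball z (min r1 r2)"
  have A: "open A" "z \<in> A" "A \<subseteq> stem_plane" "A - {z} \<subseteq> E"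
    using r1(1) r2 by (auto simp: A_def dist_commute intro!: r1(2))
  define B where "B = A \<union> cnj -` A"
  have B: "open B" "cnj_closed B" "z \<in> B" "B \<subseteq> stem_plane" "B - {z, cnj z} \<subseteq> E"
  proof -
    have "open (cnj -` A)" by (rule open_vimage[OF A(1)]) (intro continuous_intros)
    then show "open B" using A(1) by (auto simp: B_def)
    show "cnj_closed B" by (auto simp: B_def cnj_closed_def)
    show "z \<in> B" using A by (simp add: B_def)
    show "B \<subseteq> stem_plane" using A(3) cnj_stem_plane by (auto simp: B_def)
    show "B - {z, cnj z} \<subseteq> E"
    proof
      fix w assume w: "w \<in> B - {z, cnj z}"
      then consider "w \<in> A - {z}" | "cnj w \<in> A - {z}"
        by (auto simp: B_def) (metis complex_cnj_cnj)
      then show "w \<in> E"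
      proof cases
        case 2
        then have "cnj w \<in> E" using A(4) by blast
        then show ?thesis using E(2) by (metis cnj_closed_def complex_cnj_cnj)
      qed (use A(4) in blast)
    qed
  qed
  define h where "h m w a = ((w - z) * (w - cnj z)) ^ m * \<phi> w a" for m :: nat and w a
  have "\<exists>n. \<forall>m\<ge>n. (\<lambda>w. h m w a) analytic_on {z}" if "a < 4" for a
    unfolding h_def using \<phi>(2)[OF that] z(1)
    by (intro meromorphic_pole_cancel) (auto intro: meromorphic_on_subset)
  then obtain n where n: "\<And>a m. a < 4 \<Longrightarrow> m \<ge> n a \<Longrightarrow> (\<lambda>w. h m w a) analytic_on {z}"
    by metis
  \<comment> \<open>One exponent has to serve all four coordinates.\<close>
  define m where "m = Max (n ` {..<4})"
  have an: "(\<lambda>w. h m w a) analytic_on {z}" if "a < 4" for a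
    by (rule n[OF that]) (auto simp: m_def that intro!: Max_ge)
  have symh: "stem_sym (h m)"
    using \<phi>(1) by (simp add: stem_sym_def h_def mult.commute)
  have an': "(\<lambda>w. h m w a) analytic_on {cnj z}" if a: "a < 4" for a
    by (rule stem_analytic_cnj[OF symh a an[OF a]])
  have holh: "(\<lambda>w. h m w a) holomorphic_on B" if a: "a < 4" for a
  proof -
    have "(\<lambda>w. h m w a) analytic_on E"
      using hol[OF a] E(1) by (simp add: analytic_on_open h_def) (intro holomorphic_intros)
    then have "(\<lambda>w. h m w a) analytic_on (E \<union> ({z} \<union> {cnj z}))"
      using an[OF a] an'[OF a] by (simp only: analytic_on_Un)
    then have "(\<lambda>w. h m w a) analytic_on B"
      by (rule analytic_on_subset) (use B(5) in auto)
    then show ?thesis by (rule analytic_imp_holomorphic)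
  qed
  show "\<exists>V. open V \<and> circular V \<and> p \<in> V \<and> V \<subseteq> \<Omega> \<and> V - sphere_of p \<subseteq> revolve E \<and>
        (\<exists>m h. slice_regular_on V h \<and> (\<forall>q\<in>V - sphere_of p. h q =
            sphere_poly p q ^ m * the (stem_fun \<phi> E q)))"
  proof (intro exI[of _ "revolve B"] exI[of _ m] exI[of _ "stem_eval (h m)"] conjI ballI)
    show "open (revolve B)" "circular (revolve B)" using B
        by (simp_all add: open_revolve circular_revolve)
    show "p \<in> revolve B" using B by (simp add: revolve_def z_def)
    show "revolve B \<subseteq> \<Omega>" using B(4) stem_plane(3) by (auto simp: revolve_def)
    show sub: "revolve B - sphere_of p \<subseteq> revolve E"
    proof
      fix q assume q: "q \<in> revolve B - sphere_of p"
      then have "slice_coord q \<in> B" "slice_coord q \<noteq> z"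
          by (auto simp: revolve_def sphere_of_eq z_def)
      moreover from this have "slice_coord q \<noteq> cnj z"
        using Im_slice_coord[of q] z(2) by (auto simp: complex_eq_iff)
      ultimately show "q \<in> revolve E" using B(5) by (auto simp: revolve_def)
    qed
    show "slice_regular_on (revolve B) (stem_eval (h m))"
      using B(1,2) symh holh by (rule slice_regular_stem_eval)
    fix q assume "q \<in> revolve B - sphere_of p"
    then have "q \<in> revolve E" using sub by blast
    have *: "stem_eval (h m) q =
        slice_emb (unit_of q) (((slice_coord q - z) * (slice_coord q - cnj z)) ^ m) * stem_eval \<phi> q"
      unfolding stem_eval_def h_def by (simp add: stem_val_cmult[OF unit_of(1)])
    have "sphere_poly p q = slice_emb (unit_of q) ((slice_coord q - z) * (slice_coord q - cnj z))"
      using sphere_poly_emb[OF unit_of(1), of p q "slice_coord q"] by (simp add: unit_of z_def)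
    with * show "stem_eval (h m) q = sphere_poly p q ^ m * the (stem_fun \<phi> E q)"
      using \<open>q \<in> revolve E\<close> by (simp add: stem_fun_apply slice_emb_power[OF unit_of(1)])
  qed
qed

text \<open>On its domain the function has a holomorphic stem. Near an omitted sphere the extension \<open>h\<close> has
  one too, and \<open>h = \<Delta>\<^sub>p\<^sup>m f\<close> turns into an equation between the coordinates, which exhibits those
  of \<open>f\<close> as quotients of holomorphic functions on a punctured neighbourhood.\<close>

lemma semi_regular_is_stem_fun:
  assumes f: "semi_regular_on \<Omega> f"
  obtains \<phi> E where "regular_on \<phi> E" "f = stem_fun \<phi> E"
proof -
  define E where "E = stem_dom (dom f)"
  from f have sub: "dom f \<subseteq> \<Omega>" and reg: "slice_regular_on (dom f) (\<lambda>q. the (f q))"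
    by (auto simp: semi_regular_on_def)
  have of: "open (dom f)" "circular (dom f)" using reg by (auto simp: slice_regular_on_def)
  have E: "open E" "cnj_closed E" "E \<subseteq> stem_plane" "revolve E = dom f"
    using of sub by (auto simp: E_def stem_plane_def open_stem_dom cnj_closed_stem_dom
        revolve_stem_dom)
      (auto simp: stem_dom_def)
  obtain \<phi>0 where \<phi>0: "stem_sym \<phi>0" "\<And>a. a < 4 \<Longrightarrow> (\<lambda>w. \<phi>0 w a) holomorphic_on E"
    "\<And>q. q \<in> dom f \<Longrightarrow> the (f q) = stem_eval \<phi>0 q"
    using slice_regular_stem[OF reg] unfolding E_def by blast
  have near: "(\<forall>\<^sub>F w in at z. w \<in> E) \<and> (\<forall>a<4. (\<lambda>w. \<phi>0 w a) meromorphic_on {z})"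
      if z: "z \<in> stem_plane" for z
  proof (cases "z \<in> E")
    case True
    have "\<forall>\<^sub>F w in at z. w \<in> E" using E(1) True by (rule eventually_at_in_open')
    moreover have "(\<lambda>w. \<phi>0 w a) meromorphic_on {z}" if "a < 4" for a
    proof -
      have "(\<lambda>w. \<phi>0 w a) analytic_on E" using \<phi>0(2)[OF that] E(1) by (simp add: analytic_on_open)
      then show ?thesis using True
          by (intro analytic_on_imp_meromorphic_on) (auto intro: analytic_on_subset)
    qed
    ultimately show ?thesis by blast
  next
    case False
    obtain L where L: "L \<in> \<S>" by (rule imag_unit_decomp)
    define p where "p = slice_emb L z"
    have p: "p \<in> \<Omega> - dom f"
      using z False stem_dom_iff[OF circular_\<Omega> L] stem_dom_iff[OF of(2) L]
      by (auto simp: p_def stem_plane_def E_def)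
    then obtain V m h where V: "open V" "circular V" "p \<in> V" "V \<subseteq> \<Omega>" "V - sphere_of p \<subseteq> dom f"
      and h: "slice_regular_on V h" "\<And>q. q \<in> V - sphere_of p \<Longrightarrow> h q =
          sphere_poly p q ^ m * the (f q)"
      using f unfolding semi_regular_on_def by metis
    obtain \<psi> where \<psi>: "stem_sym \<psi>" "\<And>a. a < 4 \<Longrightarrow> (\<lambda>w. \<psi> w a) holomorphic_on stem_dom V"
      "\<And>q. q \<in> V \<Longrightarrow> h q = stem_eval \<psi> q"
      using slice_regular_stem[OF h(1)] by blast
    have zV: "z \<in> stem_dom V" using V(3) stem_dom_iff[OF V(2) L] by (simp add: p_def)
    have oV: "open (stem_dom V)" using V(1) by (rule open_stem_dom)
    have zp: "slice_coord p = z \<or> slice_coord p = cnj z" unfolding p_def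
        by (rule slice_coord_emb_cases[OF L])
    have ev: "\<forall>\<^sub>F w in at z. w \<in> stem_dom V \<and> w \<noteq> z \<and> w \<noteq> cnj z"
      using eventually_at_in_open'[OF oV zV] by (intro eventually_conj eventually_neq_at_within)
    have off: "slice_emb M w \<in> V - sphere_of p"
      if w: "w \<in> stem_dom V \<and> w \<noteq> z \<and> w \<noteq> cnj z" and M: "M \<in> \<S>" for M w
    proof -
      have "slice_coord (slice_emb M w) = w \<or> slice_coord (slice_emb M w) = cnj w"
          by (rule slice_coord_emb_cases[OF M])
      moreover have "cnj w \<noteq> z" using w complex_cnj_cnj[of w] by metis
      ultimately have "slice_coord (slice_emb M w) \<noteq> slice_coord p" using w zp by auto
      then show ?thesis using w stem_dom_iff[OF V(2) M] by (auto simp: sphere_of_eq)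
    qed
    have inE: "w \<in> E" if w: "w \<in> stem_dom V \<and> w \<noteq> z \<and> w \<noteq> cnj z" for w
      using off[OF w L] V(5) stem_dom_iff[OF of(2) L] by (auto simp: E_def)
    have eq: "\<phi>0 w a = \<psi> w a / ((w - z) * (w - cnj z)) ^ m"
      if w: "w \<in> stem_dom V \<and> w \<noteq> z \<and> w \<noteq> cnj z" and a: "a < 4" for w a
    proof -
      have "stem_val M (\<psi> w) = stem_val M (\<lambda>a. ((w - z) * (w - cnj z)) ^ m * \<phi>0 w a)"
          if M: "M \<in> \<S>" for M
      proof -
        have q: "slice_emb M w \<in> V" "slice_emb M w \<in> dom f" using off[OF w M] V(5) by auto
        have "stem_val M (\<psi> w) = h (slice_emb M w)" using \<psi>(3)[OF q(1)] stem_eval_emb[OF \<psi>(1) M]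
            by simp
        also have "\<dots> = sphere_poly p (slice_emb M w) ^ m * stem_eval \<phi>0 (slice_emb M w)"
          using h(2)[OF off[OF w M]] \<phi>0(3)[OF q(2)] by simp
        also have "sphere_poly p (slice_emb M w) = slice_emb M ((w - z) * (w - cnj z))"
          unfolding sphere_poly_emb[OF M] using zp by (auto simp: mult.commute)
        also have "stem_eval \<phi>0 (slice_emb M w) = stem_val M (\<phi>0 w)"
            by (rule stem_eval_emb[OF \<phi>0(1) M])
        finally show ?thesis by (simp add: stem_val_cmult[OF M] slice_emb_power[OF M])
      qed
      from stem_val_inj[OF L this[OF L] this[OF imag_units_uminus[OF L]] a]
      show ?thesis using w by simp
    qed
    have "(\<lambda>w. \<phi>0 w a) meromorphic_on {z}" if a: "a < 4" for a
    proof -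
      have "(\<lambda>w. \<psi> w a) analytic_on stem_dom V" using \<psi>(2)[OF a] oV by (simp add: analytic_on_open)
      then have "(\<lambda>w. \<psi> w a) meromorphic_on {z}"
        using zV by (intro analytic_on_imp_meromorphic_on) (auto intro: analytic_on_subset)
      then have "(\<lambda>w. \<psi> w a / ((w - z) * (w - cnj z)) ^ m) meromorphic_on {z}"
        by (intro meromorphic_intros)
      moreover have "\<forall>\<^sub>F w in at z. \<phi>0 w a = \<psi> w a / ((w - z) * (w - cnj z)) ^ m"
        using ev by eventually_elim (rule eq[OF _ a])
      ultimately show ?thesis
        using meromorphic_on_cong[of "{z}" "\<lambda>w. \<phi>0 w a"
            "\<lambda>w. \<psi> w a / ((w - z) * (w - cnj z)) ^ m" "{z}"] by simp
    qed
    moreover have "\<forall>\<^sub>F w in at z. w \<in> E" using ev by eventually_elim (rule inE)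
    ultimately show ?thesis by blast
  qed
  then have "\<forall>\<^sub>\<approx>w\<in>stem_plane. w \<in> E" using stem_plane(1) by (simp add: eventually_cosparse_open_eq)
  moreover have "(\<lambda>w. \<phi>0 w a) meromorphic_on stem_plane" if "a < 4" for a
    using near that by (subst meromorphic_on_meromorphic_at) blast
  ultimately have "regular_on \<phi>0 E" using E \<phi>0(1,2) by (simp add: regular_on_def stems_def)
  moreover have "f = stem_fun \<phi>0 E"
  proof
    fix q
    show "f q = stem_fun \<phi>0 E q"
    proof (cases "q \<in> dom f")
      case True
      then show ?thesis using \<phi>0(3)[OF True] E(4) by (auto simp: stem_fun_def)
    next
      case False
      then show ?thesis using E(4) by (auto simp: stem_fun_def restrict_map_def domIff)
    qed
  qed
  ultimately show ?thesis by (rule that)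
qed

section \<open>Classes of semi-regular functions\<close>

definition stem_eq :: "stem \<Rightarrow> stem \<Rightarrow> bool" where
  "stem_eq \<phi> \<psi> \<longleftrightarrow> (\<forall>\<^sub>\<approx>w\<in>stem_plane. \<forall>a<4. \<phi> w a = \<psi> w a)"

lemma stem_eq_refl: "stem_eq \<phi> \<phi>" by (simp add: stem_eq_def)

lemma stem_eq_sym: "stem_eq \<phi> \<psi> \<Longrightarrow> stem_eq \<psi> \<phi>"
  unfolding stem_eq_def by (auto elim: eventually_mono)

lemma stem_eq_trans:
  assumes "stem_eq \<phi> \<psi>" "stem_eq \<psi> \<theta>" shows "stem_eq \<phi> \<theta>"
  using assms unfolding stem_eq_def by eventually_elim simp

lemma regular_on_exists:
  assumes \<phi>: "\<phi> \<in> stems"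
  obtains E where "regular_on \<phi> E"
proof
  define E where "E = {w\<in>stem_plane. \<forall>a<4. (\<lambda>w. \<phi> w a) analytic_on {w}}"
  have sym: "stem_sym \<phi>" and mer: "\<And>a. a < 4 \<Longrightarrow> (\<lambda>w. \<phi> w a) meromorphic_on stem_plane"
    using \<phi> by (auto simp: stems_def)
  have an: "(\<lambda>w. \<phi> w a) analytic_on E" if "a < 4" for a
    using that by (subst analytic_on_analytic_at) (simp add: E_def)
  have o: "open {w. (\<lambda>w. \<phi> w a) analytic_on {w}}" for a
  proof (subst open_subopen, intro ballI)
    fix z assume "z \<in> {w. (\<lambda>w. \<phi> w a) analytic_on {w}}"
    then obtain d where d: "d > 0" "(\<lambda>w. \<phi> w a) holomorphic_on ball z d"
      by (auto simp: analytic_on_def)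
    then have "(\<lambda>w. \<phi> w a) analytic_on ball z d" by (simp add: analytic_on_open)
    then have "ball z d \<subseteq> {w. (\<lambda>w. \<phi> w a) analytic_on {w}}"
      by (auto intro: analytic_on_subset)
    then show "\<exists>X. open X \<and> z \<in> X \<and> X \<subseteq> {w. (\<lambda>w. \<phi> w a) analytic_on {w}}"
      using d(1) by (intro exI[of _ "ball z d"]) auto
  qed
  have "E = stem_plane \<inter> (\<Inter>a\<in>{..<4}. {w. (\<lambda>w. \<phi> w a) analytic_on {w}})" by (auto simp: E_def)
  then have "open E" using stem_plane(1) o by auto
  moreover have "cnj_closed E"
    using stem_analytic_cnj[OF sym] by (auto simp: cnj_closed_def E_def)
  moreover have "\<forall>\<^sub>\<approx>w\<in>stem_plane. w \<in> E"
  proof -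
    have "\<forall>\<^sub>\<approx>w\<in>stem_plane. \<forall>a\<in>{..<4}. (\<lambda>w. \<phi> w a) analytic_on {w}"
      by (rule eventually_ball_finite) (use mer in \<open>auto intro!:
          meromorphic_on_imp_analytic_cosparse\<close>)
    moreover have "\<forall>\<^sub>\<approx>w\<in>stem_plane. w \<in> stem_plane" using stem_plane(1)
        by (simp add: eventually_in_cosparse)
    ultimately show ?thesis by eventually_elim (simp add: E_def)
  qed
  ultimately show "regular_on \<phi> E"
    using \<phi> an by (auto simp: regular_on_def E_def intro: analytic_imp_holomorphic)
qed

text \<open>Agreement on the common domain gives agreement of the coordinates almost everywhere, because the
  coordinates are determined by the values. Conversely, holomorphic coordinates that agree off a
  discrete set agree on the whole common domain by continuity. Transitivity of the
  agreement relation is thereby reduced to that of equality almost everywhere.\<close>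

lemma stem_fun_agree_iff:
  assumes g: "regular_on \<phi> E" "regular_on \<psi> E'"
  shows "(\<forall>q\<in>dom (stem_fun \<phi> E) \<inter> dom (stem_fun \<psi> E'). stem_fun \<phi> E q = stem_fun \<psi> E' q) \<longleftrightarrow>
      stem_eq \<phi> \<psi>"
proof
  have E: "open E" "open E'" "cnj_closed E" "cnj_closed E'" "\<forall>\<^sub>\<approx>w\<in>stem_plane. w \<in> E"
      "\<forall>\<^sub>\<approx>w\<in>stem_plane. w \<in> E'"
    "E \<subseteq> stem_plane" and sym: "stem_sym \<phi>" "stem_sym \<psi>"
    and hol: "\<And>a. a < 4 \<Longrightarrow> (\<lambda>w. \<phi> w a) holomorphic_on E" "\<And>a. a < 4 \<Longrightarrow> (\<lambda>w. \<psi> w a) holomorphic_on E'"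
    using g by (auto simp: regular_on_def stems_def)
  {
    assume ag: "\<forall>q\<in>dom (stem_fun \<phi> E) \<inter> dom (stem_fun \<psi> E'). stem_fun \<phi> E q = stem_fun \<psi> E' q"
    have "\<phi> w a = \<psi> w a" if w: "w \<in> E" "w \<in> E'" and a: "a < 4" for w a
    proof -
      obtain L where L: "L \<in> \<S>" by (rule imag_unit_decomp)
      have sv: "stem_val M (\<phi> w) = stem_val M (\<psi> w)" if M: "M \<in> \<S>" for M
      proof -
        have "slice_emb M w \<in> revolve E" "slice_emb M w \<in> revolve E'" using w E M
            by (simp_all add: slice_emb_in_revolve_iff)
        then have "stem_eval \<phi> (slice_emb M w) = stem_eval \<psi> (slice_emb M w)" using ag
            by (simp add: stem_fun_apply)
        then show ?thesis by (simp add: stem_eval_emb sym M)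
      qed
      from stem_val_inj[OF L sv[OF L] sv[OF imag_units_uminus[OF L]] a] show ?thesis .
    qed
    note pt = this
    show "stem_eq \<phi> \<psi>"
      using E(5,6) unfolding stem_eq_def by eventually_elim (use pt in blast)
  }
  assume eq: "stem_eq \<phi> \<psi>"
  have pt: "\<phi> w a = \<psi> w a" if w: "w \<in> E" "w \<in> E'" and a: "a < 4" for w a
  proof -
    have "isCont (\<lambda>w. \<phi> w a) w" "isCont (\<lambda>w. \<psi> w a) w"
      using hol[OF a] w E(1,2)
          by (auto dest!: holomorphic_on_imp_continuous_on simp: continuous_on_eq_continuous_at)
    then have lim: "((\<lambda>w. \<phi> w a) \<longlongrightarrow> \<phi> w a) (at w)" "((\<lambda>w. \<psi> w a) \<longlongrightarrow> \<psi> w a) (at w)"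
      by (simp_all add: isCont_def)
    have "\<forall>\<^sub>F v in at w. \<forall>a<4. \<phi> v a = \<psi> v a"
      using eq w(1) E(7) unfolding stem_eq_def
          by (auto intro: eventually_cosparse_imp_eventually_at)
    then have "\<forall>\<^sub>F v in at w. \<phi> v a = \<psi> v a" by eventually_elim (use a in simp)
    from tendsto_cong[OF this] lim have "((\<lambda>w. \<psi> w a) \<longlongrightarrow> \<phi> w a) (at w)" by simp
    with lim(2) show ?thesis by (metis tendsto_unique trivial_limit_at)
  qed
  show "\<forall>q\<in>dom (stem_fun \<phi> E) \<inter> dom (stem_fun \<psi> E'). stem_fun \<phi> E q = stem_fun \<psi> E' q"
  proof
    fix q assume "q \<in> dom (stem_fun \<phi> E) \<inter> dom (stem_fun \<psi> E')"
    then have q: "q \<in> revolve E" "q \<in> revolve E'" by auto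
    then have "stem_eval \<phi> q = stem_eval \<psi> q" unfolding stem_eval_def
      by (intro stem_val_cong pt) (auto simp: revolve_def)
    then show "stem_fun \<phi> E q = stem_fun \<psi> E' q" using q by (simp add: stem_fun_apply)
  qed
qed

definition sem_of :: "stem \<Rightarrow> semfun" where
  "sem_of \<phi> = {f. \<exists>\<psi> E. regular_on \<psi> E \<and> stem_eq \<phi> \<psi> \<and> f = stem_fun \<psi> E}"

text \<open>The class of a function depends only on its stem up to equality almost everywhere.\<close>

lemma agree_class: "regular_on \<phi> E \<Longrightarrow> agree_rel \<Omega> `` {stem_fun \<phi> E} = sem_of \<phi>"
proof (rule subset_antisym; rule subsetI)
  fix f assume g: "regular_on \<phi> E" and "f \<in> agree_rel \<Omega> `` {stem_fun \<phi> E}"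
  then have f: "semi_regular_on \<Omega> f" and ag: "\<forall>q\<in>dom (stem_fun \<phi> E) \<inter> dom f. stem_fun \<phi> E q = f q"
    by (auto simp: agree_rel_def)
  from f obtain \<psi> E' where "regular_on \<psi> E'" "f = stem_fun \<psi> E'" by (rule semi_regular_is_stem_fun)
  with g ag show "f \<in> sem_of \<phi>" using stem_fun_agree_iff unfolding sem_of_def by blast
next
  fix f assume g: "regular_on \<phi> E" and "f \<in> sem_of \<phi>"
  then obtain \<psi> E' where f: "regular_on \<psi> E'" "stem_eq \<phi> \<psi>" "f = stem_fun \<psi> E'"
      by (auto simp: sem_of_def)
  then have "\<forall>q\<in>dom (stem_fun \<phi> E) \<inter> dom f. stem_fun \<phi> E q = f q"
      using stem_fun_agree_iff[OF g f(1)] by simp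
  then show "f \<in> agree_rel \<Omega> `` {stem_fun \<phi> E}"
    using f(1,3) g semi_regular_stem_fun by (auto simp: agree_rel_def)
qed

lemma stem_fun_in_sem_of: "regular_on \<phi> E \<Longrightarrow> stem_fun \<phi> E \<in> sem_of \<phi>"
  using stem_eq_refl by (auto simp: sem_of_def)

lemma sem_of_eq_iff:
  assumes "\<phi> \<in> stems"
  shows "sem_of \<phi> = sem_of \<psi> \<longleftrightarrow> stem_eq \<phi> \<psi>"
proof
  assume eq: "sem_of \<phi> = sem_of \<psi>"
  obtain E where E: "regular_on \<phi> E" using assms by (rule regular_on_exists)
  then have "stem_fun \<phi> E \<in> sem_of \<psi>" using eq stem_fun_in_sem_of by blast
  then obtain \<psi>' E' where p: "regular_on \<psi>' E'" "stem_eq \<psi> \<psi>'" "stem_fun \<phi> E = stem_fun \<psi>' E'"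
      by (auto simp: sem_of_def)
  then have "stem_eq \<phi> \<psi>'" using stem_fun_agree_iff[OF E p(1)] by simp
  then show "stem_eq \<phi> \<psi>" using p(2) stem_eq_sym stem_eq_trans by blast
next
  assume "stem_eq \<phi> \<psi>"
  then show "sem_of \<phi> = sem_of \<psi>" unfolding sem_of_def using stem_eq_sym stem_eq_trans by blast
qed

lemma carrier_SEM: "carrier (SEM \<Omega>) = sem_of ` stems"
proof -
  have "{f. semi_regular_on \<Omega> f} // agree_rel \<Omega> = sem_of ` stems"
  proof (rule subset_antisym; rule subsetI)
    fix A assume "A \<in> {f. semi_regular_on \<Omega> f} // agree_rel \<Omega>"
    then obtain f where f: "semi_regular_on \<Omega> f" "A = agree_rel \<Omega> `` {f}"
        by (auto simp: quotient_def)
    obtain \<phi> E where "regular_on \<phi> E" "f = stem_fun \<phi> E" using f(1)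
        by (rule semi_regular_is_stem_fun)
    then show "A \<in> sem_of ` stems" using f(2) agree_class by (auto simp: regular_on_def)
  next
    fix A assume "A \<in> sem_of ` stems"
    then obtain \<phi> where \<phi>: "\<phi> \<in> stems" "A = sem_of \<phi>" by blast
    obtain E where E: "regular_on \<phi> E" using \<phi>(1) by (rule regular_on_exists)
    show "A \<in> {f. semi_regular_on \<Omega> f} // agree_rel \<Omega>"
      using semi_regular_stem_fun[OF E] agree_class[OF E] \<phi>(2) by (auto simp: quotient_def)
  qed
  then show ?thesis by (simp add: SEM_def)
qed

definition stem_add :: "stem \<Rightarrow> stem \<Rightarrow> stem" where
  "stem_add \<phi> \<psi> = (\<lambda>w a. \<phi> w a + \<psi> w a)"

definition stem_prod :: "stem \<Rightarrow> stem \<Rightarrow> stem" where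
  "stem_prod \<phi> \<psi> = (\<lambda>w. quat_prod (\<phi> w) (\<psi> w))"

definition stem_const :: "quat \<Rightarrow> stem" where
  "stem_const c = (\<lambda>w a. of_real (frame_coord c a))"

lemma stem_add_stems: "\<phi> \<in> stems \<Longrightarrow> \<psi> \<in> stems \<Longrightarrow> stem_add \<phi> \<psi> \<in> stems"
  by (auto simp: stems_def stem_add_def stem_sym_def intro!: meromorphic_intros)

lemma stem_prod_stems: "\<phi> \<in> stems \<Longrightarrow> \<psi> \<in> stems \<Longrightarrow> stem_prod \<phi> \<psi> \<in> stems"
  by (auto simp: stems_def stem_prod_def stem_sym_def quat_prod_simps dest!: less4_cases intro!:
      meromorphic_intros)

lemma regular_on_add: "regular_on \<phi> E \<Longrightarrow> regular_on \<psi> E' \<Longrightarrow> regular_on (stem_add \<phi> \<psi>) (E \<inter> E')"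
  using stem_add_stems
  by (auto simp: regular_on_def cnj_closed_def eventually_conj_iff stem_add_def intro!:
      holomorphic_intros intro: holomorphic_on_subset)

lemma regular_on_prod:
  assumes g: "regular_on \<phi> E" "regular_on \<psi> E'" shows "regular_on (stem_prod \<phi> \<psi>) (E \<inter> E')"
proof -
  have hol: "(\<lambda>w. \<phi> w a) holomorphic_on E \<inter> E'" "(\<lambda>w. \<psi> w a) holomorphic_on E \<inter> E'" if "a < 4" for a
    using g that by (auto simp: regular_on_def intro: holomorphic_on_subset)
  have "(\<lambda>w. stem_prod \<phi> \<psi> w a) holomorphic_on E \<inter> E'" if "a < 4" for a
    using less4_cases[OF that]
    by (elim disjE) (simp_all only: stem_prod_def quat_prod_simps, (intro holomorphic_intros hol;
        simp)+)
  then show ?thesis using g stem_prod_stems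
    by (auto simp: regular_on_def cnj_closed_def eventually_conj_iff)
qed

lemma regular_on_const: "regular_on (stem_const c) stem_plane"
  using stem_plane by (auto simp: regular_on_def stem_const_def stems_def stem_sym_def
      eventually_in_cosparse)

lemma stem_const_stems: "stem_const c \<in> stems" using regular_on_const by (simp add: regular_on_def)

lemma padd_stem_fun:
  assumes "regular_on \<phi> E" "regular_on \<psi> E'" shows "padd (stem_fun \<phi> E) (stem_fun \<psi> E') =
      stem_fun (stem_add \<phi> \<psi>) (E \<inter> E')"
proof
  fix q
  have "stem_eval (stem_add \<phi> \<psi>) q = stem_eval \<phi> q + stem_eval \<psi> q"
    by (simp add: stem_eval_def stem_add_def stem_val_add)
  note add = this
  show "padd (stem_fun \<phi> E) (stem_fun \<psi> E') q = stem_fun (stem_add \<phi> \<psi>) (E \<inter> E') q"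
  proof (cases "q \<in> revolve E \<and> q \<in> revolve E'")
    case True
    moreover from this have "q \<in> revolve (E \<inter> E')" by (simp add: revolve_def)
    ultimately show ?thesis by (simp add: padd_def stem_fun_apply add)
  next
    case False
    then show ?thesis by (auto simp: padd_def stem_fun_def restrict_map_def revolve_def)
  qed
qed

lemma conjugate_imag_unit:
  assumes L: "L \<in> \<S>" and v: "(v::quat) \<noteq> 0"
  shows "inverse v * L * v \<in> \<S>" "inverse v * slice_emb L w * v = slice_emb (inverse v * L * v) w"
proof -
  have "(inverse v * L * v)\<^sup>2 = inverse v * (L * (v * inverse v) * L) * v"
    by (simp only: power2_eq_square mult.assoc)
  also have "\<dots> = - 1" using v by (simp add: imag_unit_square[OF L])
  finally show "inverse v * L * v \<in> \<S>" by (simp add: imag_units_def)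
  show "inverse v * slice_emb L w * v = slice_emb (inverse v * L * v) w"
    using v by (simp add: slice_emb_eq_scaleR distrib_left distrib_right)
qed

text \<open>The point \<open>v\<^sup>-\<^sup>1 q v\<close> at which the second factor is evaluated has the same complex coordinate as
  \<open>q\<close> and the conjugated imaginary unit.\<close>

lemma pstar_stem_fun:
  assumes g: "regular_on \<phi> E" "regular_on \<psi> E'" shows "pstar (stem_fun \<phi> E) (stem_fun \<psi> E') =
      stem_fun (stem_prod \<phi> \<psi>) (E \<inter> E')"
proof
  fix q
  have sym: "stem_sym \<psi>" and E': "cnj_closed E'" using g by (auto simp: regular_on_def stems_def)
  show "pstar (stem_fun \<phi> E) (stem_fun \<psi> E') q = stem_fun (stem_prod \<phi> \<psi>) (E \<inter> E') q"
  proof (cases "q \<in> revolve E \<and> q \<in> revolve E'")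
    case True
    let ?L = "unit_of q" and ?z = "slice_coord q" and ?v = "stem_eval \<phi> q"
    have L: "?L \<in> \<S>" "slice_emb ?L ?z = q" by (rule unit_of)+
    have ev: "stem_eval (stem_prod \<phi> \<psi>) q = stem_val ?L (quat_prod (\<phi> ?z) (\<psi> ?z))"
      by (simp add: stem_eval_def stem_prod_def)
    have "(if ?v = 0 then 0 else ?v * the (stem_fun \<psi> E' (inverse ?v * q * ?v))) =
        stem_eval (stem_prod \<phi> \<psi>) q"
    proof (cases "?v = 0")
      case True
      then show ?thesis using stem_val_star_zero[OF L(1)]
          by (simp add: ev) (simp add: stem_eval_def)
    next
      case False
      let ?M = "inverse ?v * ?L * ?v"
      have M: "?M \<in> \<S>" "inverse ?v * q * ?v = slice_emb ?M ?z"
        using conjugate_imag_unit[OF L(1) False] L(2) by metis+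
      have "?z \<in> E'" using True by (simp add: revolve_def)
      then have "slice_emb ?M ?z \<in> revolve E'" using slice_emb_in_revolve_iff[OF E' M(1)] by simp
      then have "the (stem_fun \<psi> E' (inverse ?v * q * ?v)) = stem_val ?M (\<psi> ?z)"
        unfolding M(2) by (simp add: stem_fun_apply stem_eval_emb[OF sym M(1)])
      moreover have "?v * stem_val ?M (\<psi> ?z) = stem_val ?L (quat_prod (\<phi> ?z) (\<psi> ?z))"
        by (rule stem_val_star[OF L(1) _ False]) (simp add: stem_eval_def)
      ultimately show ?thesis using False ev by simp
    qed
    then show ?thesis using True by (auto simp: pstar_def stem_fun_apply revolve_def)
  next
    case False
    then show ?thesis by (auto simp: pstar_def stem_fun_def restrict_map_def revolve_def)
  qed
qed

lemma pconst_stem_fun: "pconst \<Omega> c = stem_fun (stem_const c) stem_plane"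
proof -
  have "stem_eval (stem_const c) q = c" for q
    by (simp add: stem_eval_def stem_const_def stem_val_split flip: frame_coord_expand)
  then show ?thesis by (simp add: pconst_def stem_fun_def stem_plane(3))
qed

lemma sem_const: "sem_const \<Omega> c = sem_of (stem_const c)"
  unfolding sem_const_def pconst_stem_fun by (rule agree_class[OF regular_on_const])

lemma sem_add:
  assumes "\<phi> \<in> stems" "\<psi> \<in> stems"
  shows "sem_add \<Omega> (sem_of \<phi>) (sem_of \<psi>) = sem_of (stem_add \<phi> \<psi>)"
proof -
  have *: "agree_rel \<Omega> `` {padd f g} = sem_of (stem_add \<phi> \<psi>)"
      if fg: "f \<in> sem_of \<phi>" "g \<in> sem_of \<psi>" for f g
  proof -
    obtain \<phi>' E \<psi>' E' where f: "regular_on \<phi>' E" "stem_eq \<phi> \<phi>'" "f = stem_fun \<phi>' E"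
      and g: "regular_on \<psi>' E'" "stem_eq \<psi> \<psi>'" "g = stem_fun \<psi>' E'" using fg
          by (auto simp: sem_of_def)
    have "stem_eq (stem_add \<phi> \<psi>) (stem_add \<phi>' \<psi>')"
      using f(2) g(2) unfolding stem_eq_def stem_add_def by eventually_elim simp
    then have "sem_of (stem_add \<phi> \<psi>) = sem_of (stem_add \<phi>' \<psi>')"
        using sem_of_eq_iff stem_add_stems assms by blast
    then show ?thesis unfolding f(3) g(3) padd_stem_fun[OF f(1) g(1)]
      by (simp add: agree_class[OF regular_on_add[OF f(1) g(1)]])
  qed
  obtain E E' where "regular_on \<phi> E" "regular_on \<psi> E'" using assms regular_on_exists by metis
  then have "stem_fun \<phi> E \<in> sem_of \<phi>" "stem_fun \<psi> E' \<in> sem_of \<psi>"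
      by (simp_all add: stem_fun_in_sem_of)
  then show ?thesis unfolding sem_add_def using * by blast
qed

lemma sem_star:
  assumes "\<phi> \<in> stems" "\<psi> \<in> stems"
  shows "sem_star \<Omega> (sem_of \<phi>) (sem_of \<psi>) = sem_of (stem_prod \<phi> \<psi>)"
proof -
  have *: "agree_rel \<Omega> `` {pstar f g} = sem_of (stem_prod \<phi> \<psi>)"
      if fg: "f \<in> sem_of \<phi>" "g \<in> sem_of \<psi>" for f g
  proof -
    obtain \<phi>' E \<psi>' E' where f: "regular_on \<phi>' E" "stem_eq \<phi> \<phi>'" "f = stem_fun \<phi>' E"
      and g: "regular_on \<psi>' E'" "stem_eq \<psi> \<psi>'" "g = stem_fun \<psi>' E'" using fg
          by (auto simp: sem_of_def)
    have "stem_eq (stem_prod \<phi> \<psi>) (stem_prod \<phi>' \<psi>')"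
      using f(2) g(2) unfolding stem_eq_def stem_prod_def
      by eventually_elim (auto intro: quat_prod_cong)
    then have "sem_of (stem_prod \<phi> \<psi>) = sem_of (stem_prod \<phi>' \<psi>')"
        using sem_of_eq_iff stem_prod_stems assms by blast
    then show ?thesis unfolding f(3) g(3) pstar_stem_fun[OF f(1) g(1)]
      by (simp add: agree_class[OF regular_on_prod[OF f(1) g(1)]])
  qed
  obtain E E' where "regular_on \<phi> E" "regular_on \<psi> E'" using assms regular_on_exists by metis
  then have "stem_fun \<phi> E \<in> sem_of \<phi>" "stem_fun \<psi> E' \<in> sem_of \<psi>"
      by (simp_all add: stem_fun_in_sem_of)
  then show ?thesis unfolding sem_star_def using * by blast
qed

section \<open>Slice preserving functions\<close>

definition scalars :: "(complex \<Rightarrow> complex) set" where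
  "scalars = {u. (\<forall>w. u (cnj w) = cnj (u w)) \<and> u meromorphic_on stem_plane}"

definition scalar_stem :: "(complex \<Rightarrow> complex) \<Rightarrow> stem" where
  "scalar_stem u = (\<lambda>w a. if a = 0 then u w else 0)"

lemma scalar_stem_stems: "u \<in> scalars \<Longrightarrow> scalar_stem u \<in> stems"
  by (auto simp: scalars_def stems_def stem_sym_def scalar_stem_def intro!: meromorphic_on_const
      split: if_splits)
    (case_tac "a = 0"; simp add: meromorphic_on_const)

lemma stem_coord_scalars: "\<phi> \<in> stems \<Longrightarrow> a < 4 \<Longrightarrow> (\<lambda>w. \<phi> w a) \<in> scalars"
  by (auto simp: scalars_def stems_def stem_sym_def)

lemma stemsI: "(\<And>a. a < 4 \<Longrightarrow> (\<lambda>w. \<phi> w a) \<in> scalars) \<Longrightarrow> \<phi> \<in> stems"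
  by (auto simp: scalars_def stems_def stem_sym_def)

lemma slice_plane_eq: "slice_plane L = range (slice_emb L)"
  by (auto simp: slice_plane_def slice_pt_eq_emb) (metis complex.collapse)

text \<open>Comparing \<open>L\<close> with \<open>- L\<close> puts \<open>p\<close> and \<open>q\<close> into every slice, and two different slices meet in the
  real line.\<close>

lemma mem_slice_planes:
  assumes "\<And>L. L \<in> \<S> \<Longrightarrow> p + L * q \<in> slice_plane L"
  shows "p \<in> \<real> \<and> q \<in> \<real>"
proof -
  have pq: "p \<in> slice_plane L \<and> q \<in> slice_plane L" if L: "L \<in> \<S>" for L
  proof -
    obtain u v where u: "p + L * q = slice_emb L u" and v: "p - L * q = slice_emb L v"
    proof -
      have "p + L * q \<in> range (slice_emb L)" "p - L * q \<in> range (slice_emb (- L))"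
        using assms[OF L] assms[OF imag_units_uminus[OF L]] by (simp_all add: slice_plane_eq)
      then show ?thesis using that by (auto simp flip: slice_emb_cnj)
    qed
    let ?p = "slice_emb L ((u + v) / 2)" and ?q = "slice_emb L (- \<i> * ((u - v) / 2))"
    have "p = ?p \<and> q = ?q"
    proof (rule opposite_units_determine[OF L])
      have "(u + v) / 2 + \<i> * (- \<i> * ((u - v) / 2)) = u" "(u + v) / 2 - \<i> * (- \<i> * ((u - v) / 2)) =
          v"
        by (simp_all add: field_simps)
      then show "p + L * q = ?p + L * ?q" "p - L * q = ?p - L * ?q"
        unfolding u v slice_emb_left_unit[OF L] slice_emb_add[symmetric] slice_emb_diff[symmetric]
            by simp_all
    qed
    then show ?thesis by (auto simp: slice_plane_eq)
  qed
  have real: "r \<in> \<real>" if r: "r \<in> slice_plane (Quat 0 1 0 0)" "r \<in> slice_plane (Quat 0 0 1 0)" for r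
  proof -
    obtain u v where u: "r = slice_emb (Quat 0 1 0 0) u" and v: "r = slice_emb (Quat 0 0 1 0) v"
      using r unfolding slice_plane_eq by blast
    have "qIm1 r = 0" unfolding v by simp
    moreover have "qIm2 r = 0" "qIm3 r = 0" unfolding u by simp_all
    ultimately have "r = of_real (qRe r)" by (simp add: quat_eq_iff)
    then have "r \<in> range of_real" by blast
    then have "r \<in> \<real>" by (simp add: Reals_def)
    then show ?thesis by simp
  qed
  have "Quat 0 1 0 0 \<in> \<S>" "Quat 0 0 1 0 \<in> \<S>" by (simp_all add: imag_units_iff)
  then show ?thesis using pq real by blast
qed

lemma frame_coord_Reals: "q \<in> \<real> \<Longrightarrow> 0 < a \<Longrightarrow> a < 4 \<Longrightarrow> frame_coord q a = 0"
proof -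
  assume "q \<in> \<real>" "0 < a" "a < 4"
  then obtain r where "q = r *\<^sub>R frame_vec 0" by (auto simp: Reals_def of_real_def)
  then show ?thesis using frame_vec_orthonormal[of 0 a] \<open>0 < a\<close> \<open>a < 4\<close>
      by (simp add: frame_coord_def)
qed

text \<open>A slice preserving function has real components \<open>F1\<close> and \<open>F2\<close>, so only the coordinate along
  \<open>1\<close> survives.\<close>

lemma SEM_real_carrier_eq: "SEM_real_carrier \<Omega> = (\<lambda>u. sem_of (scalar_stem u)) ` scalars"
proof (rule subset_antisym; rule subsetI)
  fix A assume "A \<in> SEM_real_carrier \<Omega>"
  then obtain f where A: "A \<in> carrier (SEM \<Omega>)" "f \<in> A" "slice_preserving f"
    by (auto simp: SEM_real_carrier_def SEM_def)
  obtain \<phi> where \<phi>: "\<phi> \<in> stems" "A = sem_of \<phi>" using A(1) by (auto simp: carrier_SEM)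
  obtain \<psi> E where f: "regular_on \<psi> E" "stem_eq \<phi> \<psi>" "f = stem_fun \<psi> E" using A(2) \<phi>(2)
      by (auto simp: sem_of_def)
  have \<psi>: "\<psi> \<in> stems" "stem_sym \<psi>" and E: "cnj_closed E" "\<forall>\<^sub>\<approx>w\<in>stem_plane. w \<in> E"
    using f(1) by (auto simp: regular_on_def stems_def)
  have z: "\<psi> w a = 0" if w: "w \<in> E" and a: "0 < a" "a < 4" for w a
  proof -
    let ?p = "\<Sum>a<4. Re (\<psi> w a) *\<^sub>R frame_vec a" and ?q = "\<Sum>a<4. Im (\<psi> w a) *\<^sub>R frame_vec a"
    have "?p + L * ?q \<in> slice_plane L" if L: "L \<in> \<S>" for L
    proof -
      have "slice_emb L w \<in> revolve E" using w E(1) L by (simp add: slice_emb_in_revolve_iff)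
      moreover have "slice_emb L w \<in> slice_plane L" by (simp add: slice_plane_eq)
      ultimately have "the (f (slice_emb L w)) \<in> slice_plane L"
        using A(3) L unfolding slice_preserving_def f(3) by auto
      then show ?thesis using \<open>slice_emb L w \<in> revolve E\<close>
        by (simp add: f(3) stem_fun_apply stem_eval_emb[OF \<psi>(2) L] stem_val_split)
    qed
    then have "?p \<in> \<real> \<and> ?q \<in> \<real>" by (rule mem_slice_planes)
    then have "frame_coord ?p a = 0" "frame_coord ?q a = 0" using a
        by (simp_all add: frame_coord_Reals)
    then show ?thesis using a by (simp add: frame_coord_sum complex_eq_iff)
  qed
  have "\<forall>\<^sub>\<approx>w\<in>stem_plane. \<forall>a<4. \<psi> w a = scalar_stem (\<lambda>w. \<psi> w 0) w a"
    using E(2) by eventually_elim (auto simp: scalar_stem_def z)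
  then have "stem_eq \<phi> (scalar_stem (\<lambda>w. \<psi> w 0))"
    by (intro stem_eq_trans[OF f(2)]) (simp add: stem_eq_def)
  then have "A = sem_of (scalar_stem (\<lambda>w. \<psi> w 0))" using \<phi> sem_of_eq_iff by simp
  moreover have "(\<lambda>w. \<psi> w 0) \<in> scalars" using \<psi>(1) by (rule stem_coord_scalars) simp
  ultimately show "A \<in> (\<lambda>u. sem_of (scalar_stem u)) ` scalars" by blast
next
  fix A assume "A \<in> (\<lambda>u. sem_of (scalar_stem u)) ` scalars"
  then obtain u where u: "u \<in> scalars" "A = sem_of (scalar_stem u)" by blast
  obtain E where E: "regular_on (scalar_stem u) E" using scalar_stem_stems[OF u(1)]
      by (rule regular_on_exists)
  then have cE: "cnj_closed E" and sym: "stem_sym (scalar_stem u)"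
      by (auto simp: regular_on_def stems_def)
  have "slice_preserving (stem_fun (scalar_stem u) E)"
    unfolding slice_preserving_def
  proof (intro ballI subsetI)
    fix L x assume L: "L \<in> \<S>" and "x \<in> (\<lambda>q. the (stem_fun (scalar_stem u) E q)) ` (dom (stem_fun
        (scalar_stem u) E) \<inter> slice_plane L)"
    then obtain w where w: "slice_emb L w \<in> revolve E" "x =
        the (stem_fun (scalar_stem u) E (slice_emb L w))" by (auto simp: slice_plane_eq)
    then have "x = stem_val L (scalar_stem u w)"
        by (simp add: stem_fun_apply stem_eval_emb[OF sym L])
    also have "\<dots> = slice_emb L (u w)" by (simp add: stem_val_def sum4 scalar_stem_def)
    finally show "x \<in> slice_plane L" by (simp add: slice_plane_eq)
  qed
  moreover have "A \<in> {f. semi_regular_on \<Omega> f} // agree_rel \<Omega>"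
    using carrier_SEM u scalar_stem_stems by (auto simp: SEM_def)
  ultimately show "A \<in> SEM_real_carrier \<Omega>"
    unfolding SEM_real_carrier_def using u(2) stem_fun_in_sem_of[OF E] by blast
qed

section \<open>The algebra and its scalars in coordinates\<close>

lemma sem_of_eqI:
  assumes "\<phi> \<in> stems" "\<And>w a. a < 4 \<Longrightarrow> \<phi> w a = \<psi> w a" shows "sem_of \<phi> = sem_of \<psi>"
  using assms by (simp add: sem_of_eq_iff stem_eq_def)

lemma SEM_ops:
  "\<phi> \<in> stems \<Longrightarrow> \<psi> \<in> stems \<Longrightarrow> sem_of \<phi> \<oplus>\<^bsub>SEM \<Omega>\<^esub> sem_of \<psi> = sem_of (stem_add \<phi> \<psi>)"
  "\<phi> \<in> stems \<Longrightarrow> \<psi> \<in> stems \<Longrightarrow> sem_of \<phi> \<otimes>\<^bsub>SEM \<Omega>\<^esub> sem_of \<psi> = sem_of (stem_prod \<phi> \<psi>)"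
  "\<phi> \<in> stems \<Longrightarrow> \<psi> \<in> stems \<Longrightarrow> sem_of \<phi> \<odot>\<^bsub>SEM \<Omega>\<^esub> sem_of \<psi> = sem_of (stem_prod \<phi> \<psi>)"
  "\<zero>\<^bsub>SEM \<Omega>\<^esub> = sem_of (stem_const 0)"
  by (simp_all add: SEM_def sem_add sem_star sem_const)

lemma abelian_monoid_SEM: "abelian_monoid (SEM \<Omega>)"
proof (rule abelian_monoidI)
  fix x y assume xy: "x \<in> carrier (SEM \<Omega>)" "y \<in> carrier (SEM \<Omega>)"
  then obtain \<phi> \<psi> where p: "\<phi> \<in> stems" "x = sem_of \<phi>" "\<psi> \<in> stems" "y = sem_of \<psi>"
      by (auto simp: carrier_SEM)
  show "x \<oplus>\<^bsub>SEM \<Omega>\<^esub> y \<in> carrier (SEM \<Omega>)"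
    using p by (auto simp: SEM_ops carrier_SEM stem_add_stems)
  show "x \<oplus>\<^bsub>SEM \<Omega>\<^esub> y = y \<oplus>\<^bsub>SEM \<Omega>\<^esub> x"
    using p by (simp add: SEM_ops) (rule sem_of_eqI, simp_all add: stem_add_stems, simp add:
        stem_add_def)
  fix z assume "z \<in> carrier (SEM \<Omega>)"
  then obtain \<theta> where q: "\<theta> \<in> stems" "z = sem_of \<theta>" by (auto simp: carrier_SEM)
  show "(x \<oplus>\<^bsub>SEM \<Omega>\<^esub> y) \<oplus>\<^bsub>SEM \<Omega>\<^esub> z = x \<oplus>\<^bsub>SEM \<Omega>\<^esub> (y \<oplus>\<^bsub>SEM \<Omega>\<^esub> z)"
    using p q by (simp add: SEM_ops stem_add_stems) (rule sem_of_eqI, simp_all add: stem_add_stems,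
        simp add: stem_add_def add.assoc)
next
  show "\<zero>\<^bsub>SEM \<Omega>\<^esub> \<in> carrier (SEM \<Omega>)" by (simp add: SEM_ops carrier_SEM stem_const_stems)
  fix x assume "x \<in> carrier (SEM \<Omega>)"
  then obtain \<phi> where p: "\<phi> \<in> stems" "x = sem_of \<phi>" by (auto simp: carrier_SEM)
  then show "\<zero>\<^bsub>SEM \<Omega>\<^esub> \<oplus>\<^bsub>SEM \<Omega>\<^esub> x = x"
    by (simp add: SEM_ops stem_const_stems)
       (rule sem_of_eqI, simp_all add: stem_add_stems stem_const_stems, simp add: stem_add_def
           stem_const_def frame_coord_linear)
qed

lemma scalars_closed:
  "u \<in> scalars \<Longrightarrow> v \<in> scalars \<Longrightarrow> (\<lambda>w. u w + v w) \<in> scalars"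
  "u \<in> scalars \<Longrightarrow> v \<in> scalars \<Longrightarrow> (\<lambda>w. u w * v w) \<in> scalars"
  "u \<in> scalars \<Longrightarrow> (\<lambda>w. - u w) \<in> scalars"
  "u \<in> scalars \<Longrightarrow> (\<lambda>w. inverse (u w)) \<in> scalars"
  "(\<lambda>w. of_real r) \<in> scalars" "(\<lambda>w. 0) \<in> scalars" "(\<lambda>w. 1) \<in> scalars" "(\<lambda>w. of_int k) \<in> scalars"
  by (auto simp: scalars_def intro!: meromorphic_intros)

lemma scalars_sum:
  "(\<And>x. x \<in> X \<Longrightarrow> u x \<in> scalars) \<Longrightarrow> (\<lambda>w. \<Sum>x\<in>X. u x w) \<in> scalars"
  by (induction X rule: infinite_finite_induct) (simp_all add: scalars_closed)

lemma scalars_prod: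
  "(\<And>x. x \<in> X \<Longrightarrow> u x \<in> scalars) \<Longrightarrow> (\<lambda>w. \<Prod>x\<in>X. u x w) \<in> scalars"
  by (induction X rule: infinite_finite_induct) (simp_all add: scalars_closed)

lemma finsum_SEM:
  assumes "finite X" "\<And>x. x \<in> X \<Longrightarrow> \<phi> x \<in> stems"
  shows "(\<Oplus>\<^bsub>SEM \<Omega>\<^esub>x\<in>X. sem_of (\<phi> x)) = sem_of (\<lambda>w a. \<Sum>x\<in>X. \<phi> x w a)"
proof -
  interpret abelian_monoid "SEM \<Omega>" by (rule abelian_monoid_SEM)
  show ?thesis using assms
  proof (induction X)
    case empty
    show ?case by (simp add: SEM_ops) (rule sem_of_eqI, simp_all add: stem_const_stems, simp add:
        stem_const_def frame_coord_linear)
  next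
    case (insert x X)
    have s: "(\<lambda>w a. \<Sum>x\<in>X. \<phi> x w a) \<in> stems"
      by (rule stemsI, rule scalars_sum, rule stem_coord_scalars) (use insert.prems in auto)
    have "(\<Oplus>\<^bsub>SEM \<Omega>\<^esub>x\<in>insert x X. sem_of (\<phi> x)) = sem_of (\<phi> x) \<oplus>\<^bsub>SEM \<Omega>\<^esub> (\<Oplus>\<^bsub>SEM \<Omega>\<^esub>x\<in>X. sem_of (\<phi> x))"
      using insert.hyps insert.prems by (intro finsum_insert) (auto simp: carrier_SEM)
    also have "\<dots> = sem_of (stem_add (\<phi> x) (\<lambda>w a. \<Sum>x\<in>X. \<phi> x w a))"
      using insert s by (simp add: SEM_ops)
    also have "\<dots> = sem_of (\<lambda>w a. \<Sum>x\<in>insert x X. \<phi> x w a)"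
      using insert.hyps insert.prems s
          by (intro sem_of_eqI) (simp_all add: stem_add_stems, simp add: stem_add_def)
    finally show ?case .
  qed
qed

definition sem_scalar :: "(complex \<Rightarrow> complex) \<Rightarrow> semfun" where "sem_scalar u =
    sem_of (scalar_stem u)"

lemma carrier_SEM_real: "carrier (SEM_real \<Omega>) = sem_scalar ` scalars"
  by (simp add: SEM_real_def SEM_real_carrier_eq sem_scalar_def[abs_def])

lemma sem_scalar_carrier [intro, simp]: "u \<in> scalars \<Longrightarrow> sem_scalar u \<in> carrier (SEM_real \<Omega>)"
  by (simp add: carrier_SEM_real)

lemma sem_scalar_eq_iff: "u \<in> scalars \<Longrightarrow> sem_scalar u = sem_scalar v \<longleftrightarrow> (\<forall>\<^sub>\<approx>w\<in>stem_plane. u w = v w)"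
  unfolding sem_scalar_def
      by (subst sem_of_eq_iff) (simp_all add: scalar_stem_stems, simp add: stem_eq_def
          scalar_stem_def all4)

lemma SEM_real_ops:
  "u \<in> scalars \<Longrightarrow> v \<in> scalars \<Longrightarrow> sem_scalar u \<oplus>\<^bsub>SEM_real \<Omega>\<^esub> sem_scalar v = sem_scalar (\<lambda>w. u w + v w)"
  "u \<in> scalars \<Longrightarrow> v \<in> scalars \<Longrightarrow> sem_scalar u \<otimes>\<^bsub>SEM_real \<Omega>\<^esub> sem_scalar v = sem_scalar (\<lambda>w. u w * v w)"
  "\<zero>\<^bsub>SEM_real \<Omega>\<^esub> = sem_scalar (\<lambda>w. 0)"
  "\<one>\<^bsub>SEM_real \<Omega>\<^esub> = sem_scalar (\<lambda>w. 1)"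
proof -
  have one: "frame_coord 1 a = (if a = 0 then 1 else 0)" if "a < 4" for a
    using frame_vec_orthonormal[of 0 a] that by (simp add: frame_coord_def)
  show "\<zero>\<^bsub>SEM_real \<Omega>\<^esub> = sem_scalar (\<lambda>w. 0)" "\<one>\<^bsub>SEM_real \<Omega>\<^esub> = sem_scalar (\<lambda>w. 1)"
    unfolding SEM_real_def sem_scalar_def
    by (simp_all add: sem_const) (rule sem_of_eqI, simp_all add: stem_const_stems, simp add:
        stem_const_def scalar_stem_def frame_coord_linear one)+
  show "u \<in> scalars \<Longrightarrow> v \<in> scalars \<Longrightarrow> sem_scalar u \<oplus>\<^bsub>SEM_real \<Omega>\<^esub> sem_scalar v =
      sem_scalar (\<lambda>w. u w + v w)"
    unfolding SEM_real_def sem_scalar_def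
    by (simp add: sem_add scalar_stem_stems) (rule sem_of_eqI, simp_all add: scalar_stem_stems
        stem_add_stems, simp add: stem_add_def scalar_stem_def)
  show "u \<in> scalars \<Longrightarrow> v \<in> scalars \<Longrightarrow> sem_scalar u \<otimes>\<^bsub>SEM_real \<Omega>\<^esub> sem_scalar v =
      sem_scalar (\<lambda>w. u w * v w)"
    unfolding SEM_real_def sem_scalar_def
    by (simp add: sem_star scalar_stem_stems)
       (rule sem_of_eqI, simp_all add: scalar_stem_stems stem_prod_stems, auto simp add:
           stem_prod_def scalar_stem_def quat_prod_simps dest!: less4_cases)
qed

lemma cring_SEM_real: "cring (SEM_real \<Omega>)"
proof (rule cringI)
  show "abelian_group (SEM_real \<Omega>)"
  proof (rule abelian_groupI)
    fix x assume "x \<in> carrier (SEM_real \<Omega>)"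
    then obtain u where u: "u \<in> scalars" "x = sem_scalar u" by (auto simp: carrier_SEM_real)
    show "\<exists>y\<in>carrier (SEM_real \<Omega>). y \<oplus>\<^bsub>SEM_real \<Omega>\<^esub> x = \<zero>\<^bsub>SEM_real \<Omega>\<^esub>"
      by (rule bexI[of _ "sem_scalar (\<lambda>w. - u w)"]) (use u in \<open>simp_all add: SEM_real_ops
          scalars_closed\<close>)
  qed (auto simp: carrier_SEM_real SEM_real_ops scalars_closed add_ac)
  show "Group.comm_monoid (SEM_real \<Omega>)"
    by (rule comm_monoidI) (auto simp: carrier_SEM_real SEM_real_ops scalars_closed mult_ac)
qed (auto simp: carrier_SEM_real SEM_real_ops scalars_closed algebra_simps)

lemma neg_sem_scalar:
  assumes "u \<in> scalars" shows "\<ominus>\<^bsub>SEM_real \<Omega>\<^esub> sem_scalar u = sem_scalar (\<lambda>w. - u w)"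
proof -
  interpret cring "SEM_real \<Omega>" by (rule cring_SEM_real)
  show ?thesis
    by (rule minus_equality) (use assms in \<open>simp_all add: SEM_real_ops scalars_closed\<close>)
qed

lemma finsum_sem_scalar:
  assumes "finite X" "\<And>x. x \<in> X \<Longrightarrow> u x \<in> scalars" "\<And>x. x \<in> X \<Longrightarrow> h x = sem_scalar (u x)"
  shows "(\<Oplus>\<^bsub>SEM_real \<Omega>\<^esub>x\<in>X. h x) = sem_scalar (\<lambda>w. \<Sum>x\<in>X. u x w)"
proof -
  interpret cring "SEM_real \<Omega>" by (rule cring_SEM_real)
  have "(\<Oplus>\<^bsub>SEM_real \<Omega>\<^esub>x\<in>X. h x) = (\<Oplus>\<^bsub>SEM_real \<Omega>\<^esub>x\<in>X. sem_scalar (u x))"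
    by (rule finsum_cong') (use assms in auto)
  also have "\<dots> = sem_scalar (\<lambda>w. \<Sum>x\<in>X. u x w)"
    using assms(1,2) by (induction X) (simp_all add: SEM_real_ops finsum_insert scalars_sum Pi_iff)
  finally show ?thesis .
qed

lemma finprod_sem_scalar:
  assumes "finite X" "\<And>x. x \<in> X \<Longrightarrow> u x \<in> scalars" "\<And>x. x \<in> X \<Longrightarrow> h x = sem_scalar (u x)"
  shows "(\<Otimes>\<^bsub>SEM_real \<Omega>\<^esub>x\<in>X. h x) = sem_scalar (\<lambda>w. \<Prod>x\<in>X. u x w)"
proof -
  interpret cring "SEM_real \<Omega>" by (rule cring_SEM_real)
  have "(\<Otimes>\<^bsub>SEM_real \<Omega>\<^esub>x\<in>X. h x) = (\<Otimes>\<^bsub>SEM_real \<Omega>\<^esub>x\<in>X. sem_scalar (u x))"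
    by (rule finprod_cong') (use assms in auto)
  also have "\<dots> = sem_scalar (\<lambda>w. \<Prod>x\<in>X. u x w)"
    using assms(1,2) by (induction X) (simp_all add: SEM_real_ops finprod_insert scalars_prod
        Pi_iff)
  finally show ?thesis .
qed

text \<open>This makes the scalars a field. Around each point of the plane domain the function is zero at
  almost all points or nonzero at almost all points, and both alternatives are open. The plane domain may be
  disconnected, but the two alternatives are invariant under conjugation and so define disjoint open
  subsets of the connected set \<open>\<Omega>\<close>, one of which must be empty.\<close>

lemma scalar_zero_or_avoid:
  assumes u: "u \<in> scalars"
  shows "(\<forall>\<^sub>\<approx>w\<in>stem_plane. u w = 0) \<or> (\<forall>\<^sub>\<approx>w\<in>stem_plane. u w \<noteq> 0)"
proof -
  define Z where "Z = {z\<in>stem_plane. \<forall>\<^sub>F w in at z. u w = 0}"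
  define N where "N = {z\<in>stem_plane. \<forall>\<^sub>F w in at z. u w \<noteq> 0}"
  have mer: "u meromorphic_on stem_plane" and sym: "\<And>w. u (cnj w) = cnj (u w)" using u
      by (auto simp: scalars_def)
  have ball: "\<exists>r>0. ball z r \<subseteq> Z \<or> ball z r \<subseteq> N" if z: "z \<in> stem_plane" for z
  proof -
    obtain r where r: "r > 0" "ball z r \<subseteq> stem_plane" using stem_plane(1) z
        by (auto simp: open_contains_ball)
    have "u meromorphic_on ball z r" using mer r(2) by (rule meromorphic_on_subset)
    then have "(\<forall>\<^sub>\<approx>w\<in>ball z r. u w = 0) \<or> (\<forall>\<^sub>\<approx>w\<in>ball z r. u w \<noteq> 0)"
      by (rule meromorphic_imp_constant_or_avoid) auto
    then have "ball z r \<subseteq> Z \<or> ball z r \<subseteq> N"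
      using r(2) by (auto simp: eventually_cosparse_open_eq Z_def N_def)
    then show ?thesis using r(1) by blast
  qed
  have disj: "Z \<inter> N = {}"
  proof -
    have False if "\<forall>\<^sub>F w in at z. u w = 0" "\<forall>\<^sub>F w in at z. u w \<noteq> 0" for z
      using eventually_conj[OF that] by simp
    then show ?thesis by (auto simp: Z_def N_def)
  qed
  have cover: "stem_plane = Z \<union> N"
  proof
    show "stem_plane \<subseteq> Z \<union> N"
    proof
      fix z assume "z \<in> stem_plane"
      then obtain r where "r > 0" "ball z r \<subseteq> Z \<or> ball z r \<subseteq> N" using ball by blast
      then show "z \<in> Z \<union> N" using centre_in_ball[of z r] by blast
    qed
  qed (auto simp: Z_def N_def)
  have op: "open Z" "open N"
  proof -
    have "\<exists>r>0. ball z r \<subseteq> Z" if z: "z \<in> Z" for z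
    proof -
      have "z \<in> stem_plane" using z cover by blast
      then obtain r where r: "r > 0" "ball z r \<subseteq> Z \<or> ball z r \<subseteq> N" using ball by blast
      then have "z \<in> ball z r" by simp
      then show ?thesis using r z disj by blast
    qed
    then show "open Z" by (auto simp: open_contains_ball)
    have "\<exists>r>0. ball z r \<subseteq> N" if z: "z \<in> N" for z
    proof -
      have "z \<in> stem_plane" using z cover by blast
      then obtain r where r: "r > 0" "ball z r \<subseteq> Z \<or> ball z r \<subseteq> N" using ball by blast
      then have "z \<in> ball z r" by simp
      then show ?thesis using r z disj by blast
    qed
    then show "open N" by (auto simp: open_contains_ball)
  qed
  have "revolve Z \<inter> \<Omega> = {} \<or> revolve N \<inter> \<Omega> = {}"
  proof (rule connectedD[OF connected_\<Omega> open_revolve[OF op(1)] open_revolve[OF op(2)]])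
    show "revolve Z \<inter> revolve N \<inter> \<Omega> = {}" using disj by (auto simp: revolve_def)
    show "\<Omega> \<subseteq> revolve Z \<union> revolve N" using cover stem_plane(3) by (auto simp: revolve_def)
  qed
  moreover have "\<Omega> = revolve Z \<union> revolve N" using cover stem_plane(3) by (auto simp: revolve_def)
  ultimately have "\<Omega> = revolve Z \<or> \<Omega> = revolve N" by blast
  \<comment> \<open>The points of \<open>\<Omega>\<close> only see the upper half of the plane domain; the lower half is
    covered by symmetry.\<close>
  have cnjev: "\<forall>\<^sub>F w in at (cnj z). P (u w)"
    if ev: "\<forall>\<^sub>F w in at z. P (u w)" and P: "\<And>v. P (cnj v) = P v" for z P
  proof -
    obtain d where d: "d > 0" "\<And>w. w \<noteq> z \<Longrightarrow> dist w z < d \<Longrightarrow> P (u w)"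
      using ev by (auto simp: eventually_at)
    have "P (u w)" if w: "w \<noteq> cnj z" "dist w (cnj z) < d" for w
    proof -
      have "dist (cnj w) z < d" using w(2)
          by (metis complex_cnj_cnj complex_cnj_diff complex_mod_cnj dist_norm)
      then have "P (u (cnj w))" using d(2)[of "cnj w"] w(1) by (metis complex_cnj_cnj)
      then show ?thesis by (simp add: sym P)
    qed
    then show ?thesis using d(1) by (auto simp: eventually_at)
  qed
  have full: "z \<in> Y" if "\<Omega> = revolve Y" "z \<in> stem_plane" "\<And>w. w \<in> Y \<Longrightarrow> cnj w \<in> Y" for Y z
  proof -
    obtain L where L: "L \<in> \<S>" by (rule imag_unit_decomp)
    have "slice_emb L z \<in> revolve stem_plane"
        using slice_emb_in_revolve_iff[OF stem_plane(2) L] that(2) by blast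
    then have "slice_coord (slice_emb L z) \<in> Y" using that(1) stem_plane(3)
        by (auto simp: revolve_def)
    then show ?thesis using slice_coord_emb_cases[OF L, of z] that(3) by (metis complex_cnj_cnj)
  qed
  have "cnj w \<in> Z" if "w \<in> Z" for w
    using cnjev[of "\<lambda>v. v = 0" w] that by (simp add: Z_def)
  moreover have "cnj w \<in> N" if "w \<in> N" for w
    using cnjev[of "\<lambda>v. v \<noteq> 0" w] that by (simp add: N_def)
  ultimately have "stem_plane \<subseteq> Z \<or> stem_plane \<subseteq> N" using full \<open>\<Omega> = revolve Z \<or> \<Omega> = revolve N\<close>
      by blast
  then show ?thesis using stem_plane(1) by (auto simp: eventually_cosparse_open_eq Z_def N_def)
qed

section \<open>The two matrix representations\<close>

lemma sem_of_coords:
  assumes "u0 \<in> scalars" "u1 \<in> scalars" "u2 \<in> scalars" "u3 \<in> scalars"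
  shows "sem_scalar u0 \<oplus>\<^bsub>SEM \<Omega>\<^esub> sem_scalar u1 \<otimes>\<^bsub>SEM \<Omega>\<^esub> sem_const \<Omega> I
               \<oplus>\<^bsub>SEM \<Omega>\<^esub> sem_scalar u2 \<otimes>\<^bsub>SEM \<Omega>\<^esub> sem_const \<Omega> J
               \<oplus>\<^bsub>SEM \<Omega>\<^esub> sem_scalar u3 \<otimes>\<^bsub>SEM \<Omega>\<^esub> sem_const \<Omega> K
     = sem_of (\<lambda>w a. [u0 w, u1 w, u2 w, u3 w] ! a)"
proof -
  have c: "frame_coord I a = (if a = 1 then 1 else 0)" "frame_coord J a = (if a = 2 then 1 else 0)"
    "frame_coord K a = (if a = 3 then 1 else 0)" if "a < 4" for a
    using frame_vec_orthonormal[of 1 a] frame_vec_orthonormal[of 2 a] frame_vec_orthonormal[of 3 a]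
        that by (simp_all add: frame_coord_def)
  show ?thesis
    unfolding sem_scalar_def sem_const
    using assms
    by (simp add: SEM_ops stem_add_stems stem_prod_stems scalar_stem_stems stem_const_stems)
      (rule sem_of_eqI, simp_all add: stem_add_stems stem_prod_stems scalar_stem_stems
          stem_const_stems,
       auto simp: stem_add_def stem_prod_def scalar_stem_def stem_const_def quat_prod_simps c dest!:
           less4_cases)
qed

lemma sem_coords:
  assumes \<phi>: "\<phi> \<in> stems"
  shows "sem_coords \<Omega> I J K (sem_of \<phi>) =
      (sem_scalar (\<lambda>w. \<phi> w 0), sem_scalar (\<lambda>w. \<phi> w 1), sem_scalar (\<lambda>w. \<phi> w 2), sem_scalar (\<lambda>w. \<phi> w
          3))"
  unfolding sem_coords_def
proof (rule the_equality)
  have s: "(\<lambda>w. \<phi> w 0) \<in> scalars" "(\<lambda>w. \<phi> w 1) \<in> scalars" "(\<lambda>w. \<phi> w 2) \<in> scalars" "(\<lambda>w. \<phi> w 3) \<in>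
      scalars"
    using stem_coord_scalars[OF \<phi>] by simp_all
  have "sem_of \<phi> = sem_of (\<lambda>w a. [\<phi> w 0, \<phi> w 1, \<phi> w 2, \<phi> w 3] ! a)"
    by (rule sem_of_eqI[OF \<phi>]) (auto dest!: less4_cases)
  then show "case (sem_scalar (\<lambda>w. \<phi> w 0), sem_scalar (\<lambda>w. \<phi> w 1), sem_scalar (\<lambda>w. \<phi> w 2),
      sem_scalar (\<lambda>w. \<phi> w 3)) of (f0, f1, f2, f3) \<Rightarrow>
        f0 \<in> carrier (SEM_real \<Omega>) \<and> f1 \<in> carrier (SEM_real \<Omega>) \<and>
        f2 \<in> carrier (SEM_real \<Omega>) \<and> f3 \<in> carrier (SEM_real \<Omega>) \<and>
        sem_of \<phi> = f0 \<oplus>\<^bsub>SEM \<Omega>\<^esub> f1 \<otimes>\<^bsub>SEM \<Omega>\<^esub> sem_const \<Omega> I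
               \<oplus>\<^bsub>SEM \<Omega>\<^esub> f2 \<otimes>\<^bsub>SEM \<Omega>\<^esub> sem_const \<Omega> J
               \<oplus>\<^bsub>SEM \<Omega>\<^esub> f3 \<otimes>\<^bsub>SEM \<Omega>\<^esub> sem_const \<Omega> K"
    using s by (simp add: sem_of_coords)
next
  fix x
  assume x: "case x of (f0, f1, f2, f3) \<Rightarrow>
        f0 \<in> carrier (SEM_real \<Omega>) \<and> f1 \<in> carrier (SEM_real \<Omega>) \<and>
        f2 \<in> carrier (SEM_real \<Omega>) \<and> f3 \<in> carrier (SEM_real \<Omega>) \<and>
        sem_of \<phi> = f0 \<oplus>\<^bsub>SEM \<Omega>\<^esub> f1 \<otimes>\<^bsub>SEM \<Omega>\<^esub> sem_const \<Omega> I
               \<oplus>\<^bsub>SEM \<Omega>\<^esub> f2 \<otimes>\<^bsub>SEM \<Omega>\<^esub> sem_const \<Omega> J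
               \<oplus>\<^bsub>SEM \<Omega>\<^esub> f3 \<otimes>\<^bsub>SEM \<Omega>\<^esub> sem_const \<Omega> K"
  obtain f0 f1 f2 f3 where f: "x = (f0, f1, f2, f3)" by (metis surj_pair)
  obtain u0 u1 u2 u3 where u: "u0 \<in> scalars" "u1 \<in> scalars" "u2 \<in> scalars" "u3 \<in> scalars"
    "f0 = sem_scalar u0" "f1 = sem_scalar u1" "f2 = sem_scalar u2" "f3 = sem_scalar u3"
    using x unfolding f by (auto simp: carrier_SEM_real)
  have "sem_of \<phi> = sem_of (\<lambda>w a. [u0 w, u1 w, u2 w, u3 w] ! a)"
    using x u by (simp add: f sem_of_coords)
  then have "\<forall>\<^sub>\<approx>w\<in>stem_plane. \<forall>a<4. \<phi> w a = [u0 w, u1 w, u2 w, u3 w] ! a"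
    using sem_of_eq_iff[OF \<phi>] by (simp add: stem_eq_def)
  then have *: "\<forall>\<^sub>\<approx>w\<in>stem_plane. u0 w = \<phi> w 0 \<and> u1 w = \<phi> w 1 \<and> u2 w = \<phi> w 2 \<and> u3 w = \<phi> w 3"
    by eventually_elim (simp add: all4)
  then show "x = (sem_scalar (\<lambda>w. \<phi> w 0), sem_scalar (\<lambda>w. \<phi> w 1), sem_scalar (\<lambda>w. \<phi> w 2), sem_scalar
      (\<lambda>w. \<phi> w 3))"
    unfolding f u(5-8) by (auto simp: sem_scalar_eq_iff u(1-4) elim: eventually_mono)
qed

definition left_mat :: "(nat \<Rightarrow> complex) \<Rightarrow> nat \<Rightarrow> nat \<Rightarrow> complex" where
  "left_mat c i j = [[c 0, - c 1, - c 2, - c 3],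
                 [c 1, c 0,   - c 3, c 2  ],
                 [c 2, c 3,   c 0,   - c 1],
                 [c 3, - c 2, c 1,   c 0  ]] ! i ! j"

definition right_mat :: "(nat \<Rightarrow> complex) \<Rightarrow> nat \<Rightarrow> nat \<Rightarrow> complex" where
  "right_mat c i j = [[c 0, - c 1, - c 2, - c 3],
                 [c 1, c 0,   c 3,   - c 2],
                 [c 2, - c 3, c 0,   c 1  ],
                 [c 3, c 2,   - c 1, c 0  ]] ! i ! j"

lemma iota_L:
  assumes \<phi>: "\<phi> \<in> stems" and ij: "i < 4" "j < 4"
  shows "iota_L \<Omega> I J K (sem_of \<phi>) i j =
      sem_scalar (\<lambda>w. left_mat (\<phi> w) i j)" "(\<lambda>w. left_mat (\<phi> w) i j) \<in> scalars"
proof -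
  have s: "(\<lambda>w. \<phi> w 0) \<in> scalars" "(\<lambda>w. \<phi> w 1) \<in> scalars" "(\<lambda>w. \<phi> w 2) \<in> scalars" "(\<lambda>w. \<phi> w 3) \<in>
      scalars"
    using stem_coord_scalars[OF \<phi>] by simp_all
  from less4_cases[OF ij(1)] less4_cases[OF ij(2)]
  show "iota_L \<Omega> I J K (sem_of \<phi>) i j = sem_scalar (\<lambda>w. left_mat (\<phi> w) i j)"
    unfolding iota_L_def sem_coords[OF \<phi>] left_mat_def
    by (elim disjE) (use s in \<open>simp_all add: neg_sem_scalar\<close>)
  from less4_cases[OF ij(1)] less4_cases[OF ij(2)] show "(\<lambda>w. left_mat (\<phi> w) i j) \<in> scalars"
    unfolding left_mat_def by (elim disjE) (use s in \<open>simp_all add: scalars_closed\<close>)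
qed

lemma iota_R:
  assumes \<phi>: "\<phi> \<in> stems" and ij: "i < 4" "j < 4"
  shows "iota_R \<Omega> I J K (sem_of \<phi>) i j =
      sem_scalar (\<lambda>w. right_mat (\<phi> w) i j)" "(\<lambda>w. right_mat (\<phi> w) i j) \<in> scalars"
proof -
  have s: "(\<lambda>w. \<phi> w 0) \<in> scalars" "(\<lambda>w. \<phi> w 1) \<in> scalars" "(\<lambda>w. \<phi> w 2) \<in> scalars" "(\<lambda>w. \<phi> w 3) \<in>
      scalars"
    using stem_coord_scalars[OF \<phi>] by simp_all
  from less4_cases[OF ij(1)] less4_cases[OF ij(2)]
  show "iota_R \<Omega> I J K (sem_of \<phi>) i j = sem_scalar (\<lambda>w. right_mat (\<phi> w) i j)"
    unfolding iota_R_def sem_coords[OF \<phi>] right_mat_def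
    by (elim disjE) (use s in \<open>simp_all add: neg_sem_scalar\<close>)
  from less4_cases[OF ij(1)] less4_cases[OF ij(2)] show "(\<lambda>w. right_mat (\<phi> w) i j) \<in> scalars"
    unfolding right_mat_def by (elim disjE) (use s in \<open>simp_all add: scalars_closed\<close>)
qed

text \<open>Multiplication by \<open>c\<close> from the left and by \<open>c'\<close> from the right commute, so the matrix of the
  composition may be written with the left factor first although the right multiplication is
  performed last.\<close>

lemma quat_prod_matrix:
  assumes "a < 4"
  shows "quat_prod (quat_prod c d) c' a = (\<Sum>b<4. (\<Sum>k<4. left_mat c a k * right_mat c' k b) * d b)"
  using less4_cases[OF assms]
  by (elim disjE) (simp_all add: quat_prod_simps sum4 left_mat_def right_mat_def algebra_simps)

lemma mat_det_sem_scalar: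
  assumes "\<And>i j. i < n \<Longrightarrow> j < n \<Longrightarrow> \<alpha> i j \<in> scalars" "\<And>i j. i < n \<Longrightarrow> j < n \<Longrightarrow> A i j = sem_scalar (\<alpha> i j)"
  shows "mat_det (SEM_real \<Omega>) n A = sem_scalar (\<lambda>w. det (mat n n (\<lambda>(i, j). \<alpha> i j w)))"
    "(\<lambda>w. det (mat n n (\<lambda>(i, j). \<alpha> i j w))) \<in> scalars"
proof -
  have d: "det (mat n n (\<lambda>(i, j). \<alpha> i j w)) =
     (\<Sum>p\<in>{p. p permutes {..<n}}. signof p * (\<Prod>i<n. \<alpha> i (p i) w))" for w
  proof -
    have "det (mat n n (\<lambda>(i, j). \<alpha> i j w)) = (\<Sum>p\<in>{p. p permutes {..<n}}.
       signof p * (\<Prod>i<n. mat n n (\<lambda>(i, j). \<alpha> i j w) $$ (i, p i)))"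
      unfolding det_def by (simp add: atLeast0LessThan)
    also have "\<dots> = (\<Sum>p\<in>{p. p permutes {..<n}}. signof p * (\<Prod>i<n. \<alpha> i (p i) w))"
    proof (intro sum.cong refl arg_cong2[of _ _ _ _ "(*)"] prod.cong)
      fix p i assume "p \<in> {p. p permutes {..<n}}" "i \<in> {..<n}"
      moreover from this have "p i < n" using permutes_in_image[of p "{..<n}" i] by simp
      ultimately show "mat n n (\<lambda>(i, j). \<alpha> i j w) $$ (i, p i) = \<alpha> i (p i) w" by simp
    qed
    finally show ?thesis .
  qed
  have pr: "(\<lambda>w. \<Prod>i<n. \<alpha> i (p i) w) \<in> scalars" if "p permutes {..<n}" for p
    by (rule scalars_prod) (use assms(1) permutes_in_image[OF that] in auto)
  have sg: "(\<lambda>w. signof p * (\<Prod>i<n. \<alpha> i (p i) w)) \<in> scalars" if "p permutes {..<n}" for p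
    using pr[OF that] by (intro scalars_closed)
  show "(\<lambda>w. det (mat n n (\<lambda>(i, j). \<alpha> i j w))) \<in> scalars"
    unfolding d by (rule scalars_sum) (use sg in simp)
  show "mat_det (SEM_real \<Omega>) n A = sem_scalar (\<lambda>w. det (mat n n (\<lambda>(i, j). \<alpha> i j w)))"
    unfolding d mat_det_def
  proof (rule finsum_sem_scalar)
    show "finite {p. p permutes {..<n}}" by (simp add: finite_permutations)
    fix p assume "p \<in> {p. p permutes {..<n}}"
    then have p: "p permutes {..<n}" by simp
    show "(\<lambda>w. signof p * (\<Prod>i<n. \<alpha> i (p i) w)) \<in> scalars" using sg p by simp
    have "(\<Otimes>\<^bsub>SEM_real \<Omega>\<^esub>i\<in>{..<n}. A i (p i)) = sem_scalar (\<lambda>w. \<Prod>i<n. \<alpha> i (p i) w)"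
      by (rule finprod_sem_scalar) (use assms permutes_in_image[OF p] in auto)
    then show "(let t = (\<Otimes>\<^bsub>SEM_real \<Omega>\<^esub>i\<in>{..<n}. A i (p i)) in
        if evenperm p then t else \<ominus>\<^bsub>SEM_real \<Omega>\<^esub> t) =
       sem_scalar (\<lambda>w. signof p * (\<Prod>i<n. \<alpha> i (p i) w))"
      using pr[OF p] by (simp add: Let_def sign_def neg_sem_scalar)
  qed
qed

end

section \<open>Inverse matrices\<close>

lemma mat_delete_mat:
  "mat_delete (mat n n f) i j =
     mat (n - 1) (n - 1) (\<lambda>(r, c). f (if r < i then r else Suc r, if c < j then c else Suc c))"
  by (auto simp: mat_delete_def intro!: eq_matI)

text \<open>The entries are rational expressions in those of \<open>A\<close>, so applied pointwise to meromorphic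
  functions they give meromorphic functions. Where the determinant vanishes they take the default
  value 0.\<close>

definition inverse_entry :: "nat \<Rightarrow> (nat \<Rightarrow> nat \<Rightarrow> 'a::field) \<Rightarrow> nat \<Rightarrow> nat \<Rightarrow> 'a" where
  "inverse_entry n A i j =
     inverse (det (mat n n (\<lambda>(i, j). A i j))) * adj_mat (mat n n (\<lambda>(i, j). A i j)) $$ (i, j)"

lemma inverse_entry:
  fixes A :: "nat \<Rightarrow> nat \<Rightarrow> 'a::field"
  assumes det: "det (mat n n (\<lambda>(i, j). A i j)) \<noteq> 0" and ij: "i < n" "j < n"
  shows "(\<Sum>k<n. A i k * inverse_entry n A k j) = (if i = j then 1 else 0)"
    and "(\<Sum>k<n. inverse_entry n A i k * A k j) = (if i = j then 1 else 0)"
proof -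
  let ?M = "mat n n (\<lambda>(i, j). A i j)"
  have M: "?M \<in> carrier_mat n n" by simp
  note adj = adj_mat[OF M]
  have prod: "(X * Y) $$ (i, j) = (\<Sum>k<n. X $$ (i, k) * Y $$ (k, j))"
    if "X \<in> carrier_mat n n" "Y \<in> carrier_mat n n" for X Y :: "'a mat"
    using that ij by (simp add: scalar_prod_def atLeast0LessThan)
  have "(\<Sum>k<n. A i k * adj_mat ?M $$ (k, j)) = (if i = j then det ?M else 0)"
    using arg_cong[OF adj(2), of "\<lambda>X. X $$ (i, j)"] prod[OF M adj(1)] ij by (simp split: if_splits)
  moreover have "(\<Sum>k<n. A i k * inverse_entry n A k j) =
       inverse (det ?M) * (\<Sum>k<n. A i k * adj_mat ?M $$ (k, j))"
    by (simp add: inverse_entry_def sum_distrib_left mult_ac)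
  ultimately show "(\<Sum>k<n. A i k * inverse_entry n A k j) = (if i = j then 1 else 0)" using det
      by simp
  have "(\<Sum>k<n. adj_mat ?M $$ (i, k) * A k j) = (if i = j then det ?M else 0)"
    using arg_cong[OF adj(3), of "\<lambda>X. X $$ (i, j)"] prod[OF adj(1) M] ij by (simp split: if_splits)
  moreover have "(\<Sum>k<n. inverse_entry n A i k * A k j) =
       inverse (det ?M) * (\<Sum>k<n. adj_mat ?M $$ (i, k) * A k j)"
    by (simp add: inverse_entry_def sum_distrib_left mult_ac)
  ultimately show "(\<Sum>k<n. inverse_entry n A i k * A k j) = (if i = j then 1 else 0)" using det
      by simp
qed

lemma det_mult_eq_one:
  fixes A X :: "nat \<Rightarrow> nat \<Rightarrow> 'a::comm_ring_1"
  assumes "\<And>i j. i < n \<Longrightarrow> j < n \<Longrightarrow> (\<Sum>k<n. A i k * X k j) = (if i = j then 1 else 0)"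
  shows "det (mat n n (\<lambda>(i, j). A i j)) * det (mat n n (\<lambda>(i, j). X i j)) = 1"
proof -
  let ?A = "mat n n (\<lambda>(i, j). A i j)" and ?X = "mat n n (\<lambda>(i, j). X i j)"
  have "?A * ?X = 1\<^sub>m n"
    by (rule eq_matI) (simp_all add: scalar_prod_def atLeast0LessThan assms)
  then show ?thesis using det_mult[of ?A n ?X] by simp
qed

definition mat_apply :: "(nat \<Rightarrow> nat \<Rightarrow> 'a::comm_ring_1) \<Rightarrow> (nat \<Rightarrow> 'a) \<Rightarrow> nat \<Rightarrow> 'a" where
  "mat_apply A c = (\<lambda>a. \<Sum>b<4. A a b * c b)"

lemma mat_apply_cong:
  "(\<And>b. b < 4 \<Longrightarrow> c b = d b) \<Longrightarrow> mat_apply A c = mat_apply A d"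
  by (simp add: mat_apply_def)

lemma mat_apply_compose:
  assumes "\<And>i j. i < 4 \<Longrightarrow> j < 4 \<Longrightarrow> (\<Sum>k<4. A i k * B k j) = (if i = j then 1 else 0)" "a < 4"
  shows "mat_apply A (mat_apply B c) a = c a"
proof -
  have "mat_apply A (mat_apply B c) a = (\<Sum>k<4. \<Sum>b<4. A a k * B k b * c b)"
    by (simp add: mat_apply_def sum_distrib_left mult.assoc)
  also have "\<dots> = (\<Sum>b<4. (\<Sum>k<4. A a k * B k b) * c b)"
    by (subst sum.swap) (simp add: sum_distrib_right)
  also have "\<dots> = (\<Sum>b<4. if b = a then c b else 0)"
    using assms by (intro sum.cong) auto
  also have "\<dots> = c a" using assms(2) by simp
  finally show ?thesis .
qed

context stem_setup begin

section \<open>Bijectivity and the determinant\<close>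

lemma inverse_entry_scalars:
  assumes "\<And>i j. i < n \<Longrightarrow> j < n \<Longrightarrow> (\<lambda>w. A w i j) \<in> scalars" "i < n" "j < n"
  shows "(\<lambda>w. inverse_entry n (A w) i j) \<in> scalars"
proof -
  have "(\<lambda>w. det (mat n n (\<lambda>(i, j). A w i j))) \<in> scalars"
    by (rule mat_det_sem_scalar(2)) (use assms in auto)
  moreover have "(\<lambda>w. adj_mat (mat n n (\<lambda>(i, j). A w i j)) $$ (i, j)) \<in> scalars"
  proof -
    let ?s = "\<lambda>k l. if l < k then l else Suc (l::nat)"
    have "(\<lambda>w. det (mat (n - 1) (n - 1) (\<lambda>(r, c). A w (?s j r) (?s i c)))) \<in> scalars"
      by (rule mat_det_sem_scalar(2)[where A =
          "\<lambda>i j. sem_scalar (\<lambda>w. _ w i j)"]) (use assms in auto)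
    then have "(\<lambda>w. of_real ((-1) ^ (j +
        i)) * det (mat (n - 1) (n - 1) (\<lambda>(r, c). A w (?s j r) (?s i c)))) \<in> scalars"
      by (intro scalars_closed)
    then show ?thesis using assms(2,3)
      by (simp add: adj_mat_def cofactor_def mat_delete_mat)
  qed
  ultimately show ?thesis unfolding inverse_entry_def by (intro scalars_closed)
qed

lemma mat_apply_stems:
  assumes A: "\<And>i j. i < 4 \<Longrightarrow> j < 4 \<Longrightarrow> (\<lambda>w. A w i j) \<in> scalars" and \<phi>: "\<phi> \<in> stems"
  shows "(\<lambda>w. mat_apply (A w) (\<phi> w)) \<in> stems"
proof (rule stemsI)
  fix a :: nat assume a: "a < 4"
  show "(\<lambda>w. mat_apply (A w) (\<phi> w) a) \<in> scalars"
    unfolding mat_apply_def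
    by (rule scalars_sum, rule scalars_closed(2)[OF A stem_coord_scalars[OF \<phi>]]) (use a in auto)
qed

lemma stem_prod_scalar: "a < 4 \<Longrightarrow> stem_prod (scalar_stem u) \<phi> w a = u w * \<phi> w a"
  by (drule less4_cases) (auto simp: stem_prod_def scalar_stem_def quat_prod_simps)

text \<open>Surjectivity alone gives a right inverse of the matrix and hence, by multiplicativity, a nonzero
  determinant. If the determinant is not the zero class, it vanishes only on a discrete set, and
  off that set the matrix of \<open>inverse_entry\<close> is a two-sided inverse.\<close>

lemma iso_iff_det:
  assumes A: "\<And>i j. i < 4 \<Longrightarrow> j < 4 \<Longrightarrow> (\<lambda>w. A w i j) \<in> scalars"
    and h: "\<And>\<phi>. \<phi> \<in> stems \<Longrightarrow> h (sem_of \<phi>) = sem_of (\<lambda>w. mat_apply (A w) (\<phi> w))"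
  shows "h \<in> module_iso (SEM_real \<Omega>) (SEM \<Omega>) (SEM \<Omega>) \<longleftrightarrow>
     sem_scalar (\<lambda>w. det (mat 4 4 (\<lambda>(i, j). A w i j))) \<noteq> \<zero>\<^bsub>SEM_real \<Omega>\<^esub>"
proof -
  define d where "d w = det (mat 4 4 (\<lambda>(i, j). A w i j))" for w
  have d: "d \<in> scalars" unfolding d_def by (rule mat_det_sem_scalar(2)) (use A in auto)
  have hs: "(\<lambda>w. mat_apply (A w) (\<phi> w)) \<in> stems" if "\<phi> \<in> stems" for \<phi>
    using A that by (rule mat_apply_stems)
  have lin: "h (x \<oplus>\<^bsub>SEM \<Omega>\<^esub> y) = h x \<oplus>\<^bsub>SEM \<Omega>\<^esub> h y"
      if xy: "x \<in> carrier (SEM \<Omega>)" "y \<in> carrier (SEM \<Omega>)" for x y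
  proof -
    obtain \<phi> \<psi> where p: "\<phi> \<in> stems" "x = sem_of \<phi>" "\<psi> \<in> stems" "y = sem_of \<psi>" using xy
        by (auto simp: carrier_SEM)
    then show ?thesis
      by (simp add: SEM_ops h stem_add_stems hs)
        (rule sem_of_eqI, simp_all add: hs stem_add_stems, simp add: stem_add_def mat_apply_def
            distrib_left sum.distrib)
  qed
  have smult: "h (c \<odot>\<^bsub>SEM \<Omega>\<^esub> x) = c \<odot>\<^bsub>SEM \<Omega>\<^esub> h x"
    if slice_emb: "c \<in> carrier (SEM_real \<Omega>)" "x \<in> carrier (SEM \<Omega>)" for c x
  proof -
    obtain u \<phi> where p: "u \<in> scalars" "c = sem_scalar u" "\<phi> \<in> stems" "x = sem_of \<phi>"
      using slice_emb by (auto simp: carrier_SEM carrier_SEM_real)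
    have "h (c \<odot>\<^bsub>SEM \<Omega>\<^esub> x) = sem_of (\<lambda>w. mat_apply (A w) (stem_prod (scalar_stem u) \<phi> w))"
      using p by (simp add: sem_scalar_def SEM_ops h stem_prod_stems scalar_stem_stems)
    also have "\<dots> = sem_of (stem_prod (scalar_stem u) (\<lambda>w. mat_apply (A w) (\<phi> w)))"
      by (rule sem_of_eqI)
        (use p in \<open>simp_all add: hs stem_prod_stems scalar_stem_stems stem_prod_scalar\<close>, simp add:
            mat_apply_def stem_prod_scalar sum_distrib_left mult_ac)
    also have "\<dots> = c \<odot>\<^bsub>SEM \<Omega>\<^esub> h x"
      using p by (simp add: sem_scalar_def SEM_ops h hs scalar_stem_stems)
    finally show ?thesis .
  qed
  have "bij_betw h (carrier (SEM \<Omega>)) (carrier (SEM \<Omega>)) \<longleftrightarrow> sem_scalar d \<noteq> \<zero>\<^bsub>SEM_real \<Omega>\<^esub>"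
  proof
    assume bij: "bij_betw h (carrier (SEM \<Omega>)) (carrier (SEM \<Omega>))"
    have "\<exists>\<xi>\<in>stems. h (sem_of \<xi>) = sem_of (stem_const (frame_vec j))" for j
    proof -
      have "sem_of (stem_const (frame_vec j)) \<in> h ` sem_of ` stems"
        using bij stem_const_stems by (simp add: bij_betw_def carrier_SEM)
      then show ?thesis by (metis imageE)
    qed
    then obtain \<xi> where \<xi>: "\<And>j. \<xi> j \<in> stems" "\<And>j. h (sem_of (\<xi> j)) =
        sem_of (stem_const (frame_vec j))" by metis
    have "\<forall>\<^sub>\<approx>w\<in>stem_plane. \<forall>i<4. mat_apply (A w) (\<xi> j w) i = stem_const (frame_vec j) w i" for j
      using \<xi>(2)[of j] sem_of_eq_iff[OF hs[OF \<xi>(1)[of j]]] by (simp add: h \<xi>(1) stem_eq_def)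
    then have "\<forall>\<^sub>\<approx>w\<in>stem_plane. \<forall>j\<in>{..<4}. \<forall>i<4. mat_apply (A w) (\<xi> j w) i =
        stem_const (frame_vec j) w i"
      by (intro eventually_ball_finite) auto
    then have unit: "\<forall>\<^sub>\<approx>w\<in>stem_plane. d w * det (mat 4 4 (\<lambda>(i, j). \<xi> j w i)) = 1"
    proof eventually_elim
      case (elim w)
      show ?case unfolding d_def
      proof (rule det_mult_eq_one)
        fix i j :: nat assume ij: "i < 4" "j < 4"
        then have "(\<Sum>k<4. A w i k * \<xi> j w k) = of_real (frame_coord (frame_vec j) i)"
          using elim by (simp add: mat_apply_def stem_const_def)
        then show "(\<Sum>k<4. A w i k * \<xi> j w k) = (if i = j then 1 else 0)"
          using frame_vec_orthonormal[OF ij(2,1)] by (simp add: frame_coord_def)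
      qed
    qed
    show "sem_scalar d \<noteq> \<zero>\<^bsub>SEM_real \<Omega>\<^esub>"
    proof
      assume "sem_scalar d = \<zero>\<^bsub>SEM_real \<Omega>\<^esub>"
      then have "\<forall>\<^sub>\<approx>w\<in>stem_plane. d w = 0" using d by (simp add: SEM_real_ops sem_scalar_eq_iff)
      with unit have "\<forall>\<^sub>\<approx>w\<in>stem_plane. False" by eventually_elim simp
      then show False using stem_plane(4) by (simp add: eventually_False)
    qed
  next
    assume "sem_scalar d \<noteq> \<zero>\<^bsub>SEM_real \<Omega>\<^esub>"
    then have nz: "\<forall>\<^sub>\<approx>w\<in>stem_plane. d w \<noteq> 0"
      using scalar_zero_or_avoid[OF d] d by (auto simp: SEM_real_ops sem_scalar_eq_iff)
    define B where "B w = inverse_entry 4 (A w)" for w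
    have B: "(\<lambda>w. B w i j) \<in> scalars" if "i < 4" "j < 4" for i j
      unfolding B_def using A that by (rule inverse_entry_scalars)
    have Bs: "(\<lambda>w. mat_apply (B w) (\<phi> w)) \<in> stems" if "\<phi> \<in> stems" for \<phi>
      using B that by (rule mat_apply_stems)
    have AB: "mat_apply (A w) (mat_apply (B w) c) a = c a" "mat_apply (B w) (mat_apply (A w) c) a =
        c a"
      if "d w \<noteq> 0" "a < 4" for w c a
      using mat_apply_compose[OF inverse_entry(1)[OF that(1)[unfolded d_def]] that(2)]
        mat_apply_compose[OF inverse_entry(2)[OF that(1)[unfolded d_def]] that(2)]
      by (simp_all add: B_def)
    show "bij_betw h (carrier (SEM \<Omega>)) (carrier (SEM \<Omega>))"
      unfolding bij_betw_def carrier_SEM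
    proof
      show "inj_on h (sem_of ` stems)"
      proof (rule inj_onI)
        fix x y assume "x \<in> sem_of ` stems" "y \<in> sem_of ` stems" and eq: "h x = h y"
        then obtain \<phi> \<psi> where p: "\<phi> \<in> stems" "x = sem_of \<phi>" "\<psi> \<in> stems" "y = sem_of \<psi>" by blast
        then have "sem_of (\<lambda>w. mat_apply (A w) (\<phi> w)) = sem_of (\<lambda>w. mat_apply (A w) (\<psi> w))"
            using eq h by simp
        then have "\<forall>\<^sub>\<approx>w\<in>stem_plane. \<forall>a<4. mat_apply (A w) (\<phi> w) a = mat_apply (A w) (\<psi> w) a"
          using sem_of_eq_iff[OF hs[OF p(1)]] by (simp add: stem_eq_def)
        with nz have "stem_eq \<phi> \<psi>" unfolding stem_eq_def
        proof eventually_elim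
          case (elim w)
          then have "mat_apply (B w) (mat_apply (A w) (\<phi> w)) =
              mat_apply (B w) (mat_apply (A w) (\<psi> w))"
            by (intro mat_apply_cong) blast
          then show ?case using AB(2)[OF elim(1)] by metis
        qed
        then show "x = y" using p sem_of_eq_iff by simp
      qed
      show "h ` sem_of ` stems = sem_of ` stems"
      proof (rule subset_antisym; rule subsetI)
        fix x assume "x \<in> h ` sem_of ` stems"
        then show "x \<in> sem_of ` stems" using h hs by auto
      next
        fix x assume "x \<in> sem_of ` stems"
        then obtain \<phi> where p: "\<phi> \<in> stems" "x = sem_of \<phi>" by blast
        let ?\<psi> = "\<lambda>w. mat_apply (B w) (\<phi> w)"
        have "stem_eq (\<lambda>w. mat_apply (A w) (?\<psi> w)) \<phi>"
          using nz unfolding stem_eq_def by eventually_elim (simp add: AB(1))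
        then have "h (sem_of ?\<psi>) = x" using h Bs p hs sem_of_eq_iff by simp
        then show "x \<in> h ` sem_of ` stems" using Bs[OF p(1)] by blast
      qed
    qed
  qed
  then show ?thesis using lin smult unfolding module_iso_def d_def[abs_def] by blast
qed

end

theorem proposition4p3:
  fixes \<Omega> :: "quat set" and I J K :: quat and N :: nat and f g :: "nat \<Rightarrow> semfun"
  assumes "open \<Omega>" and "connected \<Omega>" and "circular \<Omega>"
    and "quat_frame I J K"
    and "1 \<le> N"
    and "\<And>n. n \<in> {1..N} \<Longrightarrow> f n \<in> carrier (SEM \<Omega>) - {\<zero>\<^bsub>SEM \<Omega>\<^esub>}"
    and "\<And>n. n \<in> {1..N} \<Longrightarrow> g n \<in> carrier (SEM \<Omega>) - {\<zero>\<^bsub>SEM \<Omega>\<^esub>}"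
  shows "sylvester_op \<Omega> N f g \<in> module_iso (SEM_real \<Omega>) (SEM \<Omega>) (SEM \<Omega>) \<longleftrightarrow>
    mat_det (SEM_real \<Omega>) 4
      (mat_sum (SEM_real \<Omega>)
        (\<lambda>n. mat_mult (SEM_real \<Omega>) 4 (iota_L \<Omega> I J K (f n)) (iota_R \<Omega> I J K (g n))) {1..N})
    \<noteq> \<zero>\<^bsub>SEM_real \<Omega>\<^esub>"
proof -
  \<comment> \<open>Over the empty set the algebra is zero and has no element that could serve as \<open>f 1\<close>.\<close>
  have "\<Omega> \<noteq> {}"
  proof
    assume "\<Omega> = {}"
    then have "carrier (SEM \<Omega>) \<subseteq> {agree_rel \<Omega> `` {Map.empty}}"
      by (auto simp: SEM_def quotient_def semi_regular_on_def)
    moreover have "\<zero>\<^bsub>SEM \<Omega>\<^esub> = agree_rel \<Omega> `` {Map.empty}"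
      using \<open>\<Omega> = {}\<close> by (simp add: SEM_def sem_const_def pconst_def)
    ultimately show False using assms(6)[of 1] assms(5) by auto
  qed
  then interpret stem_setup I J K \<Omega>
    using assms by unfold_locales auto
  have "\<forall>n\<in>{1..N}. \<exists>\<phi>\<in>stems. f n = sem_of \<phi>" "\<forall>n\<in>{1..N}. \<exists>\<phi>\<in>stems. g n = sem_of \<phi>"
    using assms(6,7) unfolding carrier_SEM by blast+
  then obtain \<phi> \<gamma> where f: "\<And>n. n \<in> {1..N} \<Longrightarrow> \<phi> n \<in> stems" "\<And>n. n \<in> {1..N} \<Longrightarrow> f n = sem_of (\<phi> n)"
    and g: "\<And>n. n \<in> {1..N} \<Longrightarrow> \<gamma> n \<in> stems" "\<And>n. n \<in> {1..N} \<Longrightarrow> g n = sem_of (\<gamma> n)"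
    by metis
  define P where "P n w i j = (\<Sum>k<4. left_mat (\<phi> n w) i k * right_mat (\<gamma> n w) k j)" for n w i j
  define A where "A w i j = (\<Sum>n\<in>{1..N}. P n w i j)" for w i j
  have Ps: "(\<lambda>w. P n w i j) \<in> scalars" if "n \<in> {1..N}" "i < 4" "j < 4" for n i j
    unfolding P_def by (intro scalars_sum scalars_closed iota_L(2) iota_R(2)) (use f g that in auto)
  have As: "(\<lambda>w. A w i j) \<in> scalars" if "i < 4" "j < 4" for i j
    unfolding A_def by (rule scalars_sum) (use Ps that in auto)
  have entry: "mat_sum (SEM_real \<Omega>)
        (\<lambda>n. mat_mult (SEM_real \<Omega>) 4 (iota_L \<Omega> I J K (f n)) (iota_R \<Omega> I J K (g n))) {1..N} i j =
      sem_scalar (\<lambda>w. A w i j)" if ij: "i < 4" "j < 4" for i j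
    unfolding mat_sum_def A_def
  proof (rule finsum_sem_scalar)
    fix n assume n: "n \<in> {1..N}"
    show "(\<lambda>w. P n w i j) \<in> scalars" using n ij by (rule Ps)
    show "mat_mult (SEM_real \<Omega>) 4 (iota_L \<Omega> I J K (f n)) (iota_R \<Omega> I J K (g n)) i j =
        sem_scalar (\<lambda>w. P n w i j)"
      unfolding mat_mult_def P_def
    proof (rule finsum_sem_scalar)
      fix k :: nat assume "k \<in> {..<4}"
      then have k: "k < 4" by simp
      note L = iota_L[OF f(1)[OF n] ij(1) k] and R = iota_R[OF g(1)[OF n] k ij(2)]
      show "(\<lambda>w. left_mat (\<phi> n w) i k * right_mat (\<gamma> n w) k j) \<in> scalars"
        using L(2) R(2) by (rule scalars_closed)
      show "iota_L \<Omega> I J K (f n) i k \<otimes>\<^bsub>SEM_real \<Omega>\<^esub> iota_R \<Omega> I J K (g n) k j =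
          sem_scalar (\<lambda>w. left_mat (\<phi> n w) i k * right_mat (\<gamma> n w) k j)"
        unfolding f(2)[OF n] g(2)[OF n] L(1) R(1) using L(2) R(2) by (rule SEM_real_ops(2))
    qed simp
  qed simp
  have op: "sylvester_op \<Omega> N f g (sem_of \<theta>) = sem_of (\<lambda>w. mat_apply (A w) (\<theta> w))"
      if \<theta>: "\<theta> \<in> stems" for \<theta>
  proof -
    let ?\<pi> = "\<lambda>n. stem_prod (stem_prod (\<phi> n) \<theta>) (\<gamma> n)"
    have \<pi>: "?\<pi> n \<in> stems" if "n \<in> {1..N}" for n using that f(1) g(1) \<theta>
        by (simp add: stem_prod_stems)
    interpret abelian_monoid "SEM \<Omega>" by (rule abelian_monoid_SEM)
    have "sylvester_op \<Omega> N f g (sem_of \<theta>) = (\<Oplus>\<^bsub>SEM \<Omega>\<^esub>n\<in>{1..N}. sem_of (?\<pi> n))"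
      unfolding sylvester_op_def
    proof (rule finsum_cong')
      show "(\<lambda>n. sem_of (?\<pi> n)) \<in> {1..N} \<rightarrow> carrier (SEM \<Omega>)" using \<pi> by (auto simp: carrier_SEM)
      fix n assume n: "n \<in> {1..N}"
      then show "f n \<otimes>\<^bsub>SEM \<Omega>\<^esub> sem_of \<theta> \<otimes>\<^bsub>SEM \<Omega>\<^esub> g n = sem_of (?\<pi> n)"
        by (simp add: f g \<theta> SEM_ops stem_prod_stems)
    qed simp
    also have "\<dots> = sem_of (\<lambda>w a. \<Sum>n\<in>{1..N}. ?\<pi> n w a)"
      by (rule finsum_SEM) (use \<pi> in auto)
    also have "\<dots> = sem_of (\<lambda>w. mat_apply (A w) (\<theta> w))"
    proof (rule sem_of_eqI)
      show "(\<lambda>w a. \<Sum>n\<in>{1..N}. ?\<pi> n w a) \<in> stems"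
        by (rule stemsI, rule scalars_sum, rule stem_coord_scalars) (use \<pi> in auto)
      fix w and a :: nat assume a: "a < 4"
      have "(\<Sum>n\<in>{1..N}. ?\<pi> n w a) = (\<Sum>n\<in>{1..N}. \<Sum>b<4. P n w a b * \<theta> w b)"
        by (simp add: stem_prod_def quat_prod_matrix[OF a] P_def)
      also have "\<dots> = mat_apply (A w) (\<theta> w) a"
        by (subst sum.swap) (simp add: mat_apply_def A_def sum_distrib_right)
      finally show "(\<Sum>n\<in>{1..N}. ?\<pi> n w a) = mat_apply (A w) (\<theta> w) a" .
    qed
    finally show ?thesis .
  qed
  have "mat_det (SEM_real \<Omega>) 4 (mat_sum (SEM_real \<Omega>)
        (\<lambda>n. mat_mult (SEM_real \<Omega>) 4 (iota_L \<Omega> I J K (f n)) (iota_R \<Omega> I J K (g n))) {1..N})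
      = sem_scalar (\<lambda>w. det (mat 4 4 (\<lambda>(i, j). A w i j)))"
    using As entry by (rule mat_det_sem_scalar(1))
  then show ?thesis using iso_iff_det[OF As op] by simp
qed

end
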